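(* Let $X$ be a ball Banach function space on $\mathbb{R}^n$ such that the Hardy-Littlewood maximal operator $M$ is bounded on the associate space $X'$, and let $b\in L^1_{loc}(\mathbb{R}^n)$. If the commutator $[b,M]$ is bounded from $X$ to $X$, then $b\in BMO(\mathbb{R}^n)$ with $b^-\in L^\infty(\mathbb{R}^n)$.
   Context: Cubes have sides parallel to the coordinate axes. $Mf(x):=\sup_{Q\ni x}\frac{1}{|Q|}\int_Q|f(y)|\,dy$ and $[b,M](f):=bM(f)-M(bf)$; boundedness means $\|[b,M](f)\|_X\le C\|f\|_X$ for all $f\in X$. $b^-:=-\min\{b,0\}$. $BMO(\mathbb{R}^n)$ is the space of $f\in L^1_{loc}(\mathbb{R}^n)$ with $\sup_Q\frac{1}{|Q|}\int_Q|f-f_Q|\,dx<\infty$, $f_Q=\frac{1}{|Q|}\int_Qf$, over all cubes $Q$. A ball Banach function space $X$ is a Banach space of measurable functions on $\mathbb{R}^n$ whose norm satisfies, for all $f,g\in X$: (1) $\|f\|_X=\||f|\|_X$; (2) if $|f|\le|g|$ a.e., then $\|f\|_X\le\|g\|_X$; (3) if $\{f_k\}\subset X$ and $|f_k|$ increases to $|f|$ a.e., then $\|f_k\|_X$ increases to $\|f\|_X$; (4) if $E\subset\mathbb{R}^n$ is bounded, then $\|\chi_E\|_X<\infty$; (5) if $E$ is bounded, then $\int_E|f(x)|\,dx\le C\|f\|_X$ with $C=C(E,X)$. The associate space $X'$ is the ball Banach function space with norm $\|g\|_{X'}=\sup\{\int_{\mathbb{R}^n}|f g|\,dx:\|f\|_X\le1\}$;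 it satisfies $\|f\|_X\approx\sup_{g\in X',\|g\|_{X'}\le1}\int_{\mathbb{R}^n}f(x)g(x)\,dx$ and $\int|fg|\lesssim\|f\|_X\|g\|_{X'}$. *)

theory Defs
  imports "HOL-Analysis.Analysis"
begin

definition is_cube :: "'a::euclidean_space set \<Rightarrow> bool" where
  "is_cube Q \<longleftrightarrow> (\<exists>a l. 0 < l \<and> Q = cbox a (a + l *\<^sub>R One))"

definition L1_loc :: "('a::euclidean_space \<Rightarrow> real) set" where
  "L1_loc = {f. \<forall>K. compact K \<longrightarrow> set_integrable lebesgue K f}"

definition L_inf :: "('a::euclidean_space \<Rightarrow> real) set" where
  "L_inf = {f \<in> borel_measurable lebesgue. \<exists>C. AE x in lebesgue. \<bar>f x\<bar> \<le> C}"

definition avg :: "'a::euclidean_space set \<Rightarrow> ('a \<Rightarrow> real) \<Rightarrow> real" where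
  "avg Q f = (LINT x:Q|lebesgue. f x) / measure lebesgue Q"

definition BMO :: "('a::euclidean_space \<Rightarrow> real) set" where
  "BMO = {f \<in> L1_loc. bdd_above ((\<lambda>Q. avg Q (\<lambda>x. \<bar>f x - avg Q f\<bar>)) ` {Q. is_cube Q})}"

definition neg_part :: "('a \<Rightarrow> real) \<Rightarrow> 'a \<Rightarrow> real" where
  "neg_part b = (\<lambda>x. - min (b x) 0)"

definition HL_maximal :: "('a::euclidean_space \<Rightarrow> real) \<Rightarrow> 'a \<Rightarrow> ennreal" where
  "HL_maximal f x =
     (SUP Q\<in>{Q. is_cube Q \<and> x \<in> Q}.
        (\<integral>\<^sup>+y\<in>Q. ennreal \<bar>f y\<bar> \<partial>lebesgue) / emeasure lebesgue Q)"

text \<open>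
  The commutator is extended-real-valued, because the maximal functions may be infinite.
  In \<^typ>\<open>ereal\<close>, the undefined difference of two infinities is an infinite value and
  \<open>0 * \<infinity> = 0\<close>, so a finite value is never obtained from an undefined difference.
\<close>

definition max_commutator ::
    "('a::euclidean_space \<Rightarrow> real) \<Rightarrow> ('a \<Rightarrow> real) \<Rightarrow> 'a \<Rightarrow> ereal" where
  "max_commutator b f x =
     ereal (b x) * enn2ereal (HL_maximal f x) - enn2ereal (HL_maximal (\<lambda>y. b y * f y) x)"

text \<open>
  A space is given by its carrier \<open>X\<close> and its norm \<open>N\<close>, of which only the values on \<open>X\<close> matter;
  a function has finite norm when it belongs to \<open>X\<close>.  Functions that agree almost everywhere are
  identified: by \<open>AE_closed\<close> the carrier is a union of equivalence classes, and by \<open>norm_mono\<close>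
  the norm does not depend on the representative.  In \<open>norm_mono\<close> and \<open>norm_Fatou\<close> all functions,
  including the dominated one and the limit, are taken from \<open>X\<close>.
\<close>

locale ball_Banach_function_space =
  fixes X :: "('a::euclidean_space \<Rightarrow> real) set"
    and N :: "('a \<Rightarrow> real) \<Rightarrow> real"
  assumes measurable: "f \<in> X \<Longrightarrow> f \<in> borel_measurable lebesgue"
    and AE_closed: "\<lbrakk>f \<in> X; g \<in> borel_measurable lebesgue; AE x in lebesgue. g x = f x\<rbrakk> \<Longrightarrow> g \<in> X"
    and add_closed: "\<lbrakk>f \<in> X; g \<in> X\<rbrakk> \<Longrightarrow> (\<lambda>x. f x + g x) \<in> X"
    and scale_closed: "f \<in> X \<Longrightarrow> (\<lambda>x. c * f x) \<in> X"
    and norm_triangle: "\<lbrakk>f \<in> X; g \<in> X\<rbrakk> \<Longrightarrow> N (\<lambda>x. f x + g x) \<le> N f + N g"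
    and norm_scale: "f \<in> X \<Longrightarrow> N (\<lambda>x. c * f x) = \<bar>c\<bar> * N f"
    and norm_eq_0: "\<lbrakk>f \<in> X; N f = 0\<rbrakk> \<Longrightarrow> AE x in lebesgue. f x = 0"
    and complete:
      "\<lbrakk>\<And>k. F k \<in> X; \<And>e. 0 < e \<Longrightarrow> \<exists>K. \<forall>i\<ge>K. \<forall>j\<ge>K. N (\<lambda>x. F i x - F j x) < e\<rbrakk>
         \<Longrightarrow> \<exists>f\<in>X. (\<lambda>k. N (\<lambda>x. F k x - f x)) \<longlonglongrightarrow> 0"
    and abs_closed: "f \<in> X \<Longrightarrow> (\<lambda>x. \<bar>f x\<bar>) \<in> X"
    and norm_abs: "f \<in> X \<Longrightarrow> N f = N (\<lambda>x. \<bar>f x\<bar>)"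
    and norm_mono: "\<lbrakk>f \<in> X; g \<in> X; AE x in lebesgue. \<bar>f x\<bar> \<le> \<bar>g x\<bar>\<rbrakk> \<Longrightarrow> N f \<le> N g"
    and norm_Fatou:
      "\<lbrakk>\<And>k. F k \<in> X; f \<in> X;
        AE x in lebesgue. incseq (\<lambda>k. \<bar>F k x\<bar>) \<and> (\<lambda>k. \<bar>F k x\<bar>) \<longlonglongrightarrow> \<bar>f x\<bar>\<rbrakk>
         \<Longrightarrow> incseq (\<lambda>k. N (F k)) \<and> (\<lambda>k. N (F k)) \<longlonglongrightarrow> N f"
    and indicator_closed: "\<lbrakk>bounded E; E \<in> sets lebesgue\<rbrakk> \<Longrightarrow> indicat_real E \<in> X"
    and local_integral_bound:
      "\<lbrakk>bounded E; E \<in> sets lebesgue\<rbrakk> \<Longrightarrow>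
         \<exists>C. \<forall>f\<in>X. (\<integral>\<^sup>+x\<in>E. ennreal \<bar>f x\<bar> \<partial>lebesgue) \<le> ennreal (C * N f)"

text \<open>
  The associate norm depends only on \<open>\<bar>g\<bar>\<close>, so it takes the modulus as its argument; this
  also covers maximal functions, which may take the value \<open>\<infinity>\<close>.
\<close>

definition assoc_norm ::
    "('a::euclidean_space \<Rightarrow> real) set \<Rightarrow> (('a \<Rightarrow> real) \<Rightarrow> real) \<Rightarrow> ('a \<Rightarrow> ennreal) \<Rightarrow> ennreal" where
  "assoc_norm X N g = (SUP f\<in>{f \<in> X. N f \<le> 1}. \<integral>\<^sup>+x. ennreal \<bar>f x\<bar> * g x \<partial>lebesgue)"

definition assoc_space ::
    "('a::euclidean_space \<Rightarrow> real) set \<Rightarrow> (('a \<Rightarrow> real) \<Rightarrow> real) \<Rightarrow> ('a \<Rightarrow> real) set" where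
  "assoc_space X N =
     {g \<in> borel_measurable lebesgue. assoc_norm X N (\<lambda>x. ennreal \<bar>g x\<bar>) < \<infinity>}"

definition maximal_bounded_on_assoc ::
    "('a::euclidean_space \<Rightarrow> real) set \<Rightarrow> (('a \<Rightarrow> real) \<Rightarrow> real) \<Rightarrow> bool" where
  "maximal_bounded_on_assoc X N \<longleftrightarrow>
     (\<exists>C::real. \<forall>g\<in>assoc_space X N.
        assoc_norm X N (HL_maximal g) \<le> ennreal C * assoc_norm X N (\<lambda>x. ennreal \<bar>g x\<bar>))"

text \<open>
  The commutator of \<open>f\<close> belongs to \<open>X\<close> when it is almost everywhere finite and equal to a
  member \<open>h\<close> of \<open>X\<close>; its norm is then \<open>N h\<close>.
\<close>

definition max_commutator_bounded ::
    "('a::euclidean_space \<Rightarrow> real) set \<Rightarrow> (('a \<Rightarrow> real) \<Rightarrow> real) \<Rightarrow> ('a \<Rightarrow> real) \<Rightarrow> bool" where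
  "max_commutator_bounded X N b \<longleftrightarrow>
     (\<exists>C. \<forall>f\<in>X. \<exists>h\<in>X. (AE x in lebesgue. max_commutator b f x = ereal (h x)) \<and> N h \<le> C * N f)"

end

theory Submission imports Defs begin

text \<open>
  The commutator is tested on indicators of cubes.  On a cube \<open>Q\<close> the maximal function of \<open>\<chi>\<close>, the
  indicator of \<open>Q\<close>, is \<open>1\<close>, while that of \<open>b \<chi>\<close> is at least the average of \<open>\<bar>b\<bar>\<close> over \<open>Q\<close>.  So the
  function \<open>h = [b, M] \<chi>\<close> satisfies \<open>avg Q \<bar>b\<bar> - b \<le> \<bar>h\<bar>\<close> on \<open>Q\<close>.  If the average of \<open>\<bar>h\<bar>\<close> over \<open>Q\<close>
  is bounded independently of \<open>Q\<close>, both conclusions follow: \<open>b\<close> lies below its own average by at most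
  \<open>\<bar>h\<bar>\<close>, which bounds the mean oscillation, and the average of \<open>\<bar>b\<bar> - b\<close>, which is twice that of the
  negative part, is bounded as well (\<open>oscillation_and_neg_part_bound\<close>).  A function whose averages over
  cubes are bounded is itself bounded (\<open>AE_le_of_cubes\<close>).

  The average of \<open>\<bar>h\<bar>\<close> is at most \<open>N h\<close> times the associate norm of \<open>\<chi>\<close>, divided by \<open>\<bar>Q\<bar>\<close>, and \<open>N h\<close> is at
  most a multiple of \<open>N \<chi>\<close>.  So what is needed is that the product of the norms of \<open>\<chi>\<close> in \<open>X\<close> and in
  the associate space is at most a multiple of \<open>\<bar>Q\<bar>\<close> (\<open>norm_indicator_mult_integral_le\<close>).  This comes from
  the boundedness of \<open>M\<close> on the associate space, applied to a function \<open>g\<close> there whose pairing with \<open>\<chi>\<close>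
  nearly attains the norm of \<open>\<chi>\<close>.

  The existence of such a \<open>g\<close> (\<open>norming_function\<close>) is the analytic core.  A continuous functional on
  \<open>X\<close> from the Hahn-Banach theorem need not be given by a function, so \<open>g\<close> is constructed as
  \<open>\<chi> - p\<close>, where \<open>p\<close> is the function nearest to \<open>\<chi>\<close> in mean square among those with \<open>0 \<le> p \<le> \<chi>\<close> and
  \<open>N p \<le> r\<close> for a given \<open>r < N \<chi>\<close>.  The nearest point exists by the parallelogram identity
  (\<open>least_squares_attained\<close>) and the monotone convergence axiom of \<open>X\<close>, and its variational
  inequality says precisely that \<open>g\<close> is norming up to the factor \<open>r\<close>.
\<close>

section \<open>Functions with bounded averages over cubes\<close>

lemma is_cubeD:
  fixes Q :: "'a::euclidean_space set"
  assumes "is_cube Q"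
  shows compact_cube: "compact Q" and bounded_cube: "bounded Q"
    and sets_cube: "Q \<in> sets lebesgue"
    and measure_cube_pos: "0 < measure lebesgue Q"
    and emeasure_cube: "emeasure lebesgue Q = ennreal (measure lebesgue Q)"
proof -
  obtain a :: 'a and l where l: "0 < l" and Q: "Q = cbox a (a + l *\<^sub>R One)"
    using assms unfolding is_cube_def by blast
  show "compact Q" "bounded Q" "Q \<in> sets lebesgue"
    using Q by auto
  have "measure lebesgue Q = (\<Prod>i\<in>(Basis :: 'a set). l)"
    unfolding Q using l by (subst measure_completion) (auto simp: inner_simps)
  then show "0 < measure lebesgue Q"
    using l by simp
  have "emeasure lebesgue Q \<noteq> \<infinity>"
    unfolding Q using emeasure_lborel_cbox_finite[of a "a + l *\<^sub>R One"] by (simp add: less_top)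
  then show "emeasure lebesgue Q = ennreal (measure lebesgue Q)"
    by (simp add: emeasure_eq_ennreal_measure)
qed

text \<open>
  An open set is filled, up to a null set, by non-overlapping cubes, so the bound passes from cubes
  to open sets, and from there to \<open>A\<close> by outer regularity.  This takes the place of the Lebesgue
  differentiation theorem.
\<close>

lemma nn_integral_bounded_set_le_of_cubes:
  fixes f :: "'a::euclidean_space \<Rightarrow> ennreal"
  assumes f: "f \<in> borel_measurable lebesgue" and "0 \<le> c"
    and cubes: "\<And>Q. is_cube Q \<Longrightarrow> (\<integral>\<^sup>+x\<in>Q. f x \<partial>lebesgue) \<le> ennreal c * emeasure lebesgue Q"
    and A: "A \<in> sets lebesgue" "bounded A"
  shows "(\<integral>\<^sup>+x\<in>A. f x \<partial>lebesgue) \<le> ennreal c * emeasure lebesgue A"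
proof -
  have "(\<integral>\<^sup>+x\<in>A. f x \<partial>lebesgue) \<le> ennreal c * emeasure lebesgue A + ennreal c * ennreal e"
    if "0 < e" for e
  proof -
    obtain T where T: "open T" "A \<subseteq> T" "T - A \<in> lmeasurable" "emeasure lebesgue (T - A) < ennreal e"
      using sets_lebesgue_outer_open[OF A(1) \<open>0 < e\<close>] by blast
    obtain B where B: "0 < B" "\<And>x. x \<in> A \<Longrightarrow> norm x \<le> B"
      using A(2) bounded_pos by blast
    define u where "u = (- B) *\<^sub>R (One :: 'a)"
    define v where "v = B *\<^sub>R (One :: 'a)"
    have Auv: "A \<subseteq> cbox u v"
    proof
      fix x assume "x \<in> A"
      then have "\<bar>x \<bullet> i\<bar> \<le> B" if "i \<in> Basis" for i
        using B(2) Basis_le_norm[OF that, of x] by (meson order_trans)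
      then show "x \<in> cbox u v"
        unfolding u_def v_def mem_box by (force simp: abs_le_iff)
    qed
    have uv: "box u v \<noteq> {}"
      unfolding u_def v_def box_ne_empty using B(1) by auto
    \<comment> \<open>With this gauge each cube of the covering, which contains a point of \<open>A\<close>, lies inside \<open>T\<close>.\<close>
    have "gauge (\<lambda>x. if x \<in> T then T else UNIV)"
      using T(1) by (auto simp: gauge_def)
    from covering_lemma[OF Auv uv this] obtain \<D> where
      D: "countable \<D>" "\<And>K. K \<in> \<D> \<Longrightarrow> interior K \<noteq> {} \<and> (\<exists>c d. K = cbox c d)"
        "pairwise (\<lambda>A B. interior A \<inter> interior B = {}) \<D>"
        "\<And>K. K \<in> \<D> \<Longrightarrow> \<exists>x\<in>A \<inter> K. K \<subseteq> (if x \<in> T then T else UNIV)"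
        "\<And>p q. cbox p q \<in> \<D> \<Longrightarrow> \<exists>n. \<forall>i\<in>Basis. q \<bullet> i - p \<bullet> i = (v \<bullet> i - u \<bullet> i) / 2 ^ n"
        "A \<subseteq> \<Union>\<D>"
      by metis
    have cube: "is_cube K" if K_in: "K \<in> \<D>" for K
    proof -
      obtain p q where K: "K = cbox p q" using D(2)[OF K_in] by blast
      obtain n where n: "\<forall>i\<in>Basis. q \<bullet> i - p \<bullet> i = (v \<bullet> i - u \<bullet> i) / 2 ^ n"
        using D(5) K_in K by blast
      have "q = p + (2 * B / 2 ^ n) *\<^sub>R One"
      proof (rule euclidean_eqI)
        fix i :: 'a assume "i \<in> Basis"
        then have "q \<bullet> i - p \<bullet> i = 2 * B / 2 ^ n"
          using n by (simp add: u_def v_def)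
        then show "q \<bullet> i = (p + (2 * B / 2 ^ n) *\<^sub>R One) \<bullet> i"
          using \<open>i \<in> Basis\<close> by (simp add: inner_simps)
      qed
      moreover have "0 < 2 * B / 2 ^ n" using B(1) by simp
      ultimately show ?thesis unfolding is_cube_def K by blast
    qed
    have interior_eq: "emeasure lebesgue (interior K) = emeasure lebesgue K" if K_in: "K \<in> \<D>" for K
    proof -
      obtain p q where K: "K = cbox p q" using D(2)[OF K_in] by blast
      show ?thesis using D(2)[OF K_in]
        by (auto simp: K interior_cbox emeasure_lborel_box_eq emeasure_lborel_cbox_eq)
    qed
    \<comment> \<open>Interiors are genuinely disjoint, so the measures of the cubes can be added; the boundaries
      that are lost form a null set.\<close>
    define U where "U = (\<Union>K\<in>\<D>. interior K)"
    have U: "U \<in> sets lebesgue"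
      unfolding U_def by (simp add: borel_open open_UN)
    have "negligible (\<Union>K\<in>\<D>. K - interior K)"
    proof (rule negligible_countable_Union)
      show "countable ((\<lambda>K. K - interior K) ` \<D>)" using D(1) by simp
      fix S assume "S \<in> (\<lambda>K. K - interior K) ` \<D>"
      then obtain K where "K \<in> \<D>" "S = K - interior K" by blast
      then show "negligible S"
        using D(2)[of K] by (auto simp: interior_cbox negligible_frontier_interval)
    qed
    then have null: "AE x in lebesgue. x \<notin> (\<Union>K\<in>\<D>. K - interior K)"
      unfolding negligible_iff_null_sets by (rule AE_not_in)
    have disj: "disjoint_family_on interior \<D>"
      using D(3) by (auto simp: disjoint_family_on_def pairwise_def)
    have "(\<integral>\<^sup>+x\<in>A. f x \<partial>lebesgue) \<le> (\<integral>\<^sup>+x\<in>U. f x \<partial>lebesgue)"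
    proof (rule nn_integral_mono_AE)
      show "AE x in lebesgue. f x * indicator A x \<le> f x * indicator U x"
        using null by eventually_elim (use D(6) in \<open>auto simp: U_def indicator_def\<close>)
    qed
    also have "\<dots> = emeasure (density lebesgue f) U"
      using f U by (simp add: emeasure_density)
    also have "\<dots> = (\<integral>\<^sup>+K. emeasure (density lebesgue f) (interior K) \<partial>count_space \<D>)"
      unfolding U_def by (rule emeasure_UN_countable) (use D(1) disj in auto)
    also have "\<dots> \<le> (\<integral>\<^sup>+K. ennreal c * emeasure lebesgue (interior K) \<partial>count_space \<D>)"
    proof (rule nn_integral_mono)
      fix K assume "K \<in> space (count_space \<D>)"
      then have K: "K \<in> \<D>" by simp
      have "emeasure (density lebesgue f) (interior K) = (\<integral>\<^sup>+x\<in>interior K. f x \<partial>lebesgue)"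
        using f by (simp add: emeasure_density)
      also have "\<dots> \<le> (\<integral>\<^sup>+x\<in>K. f x \<partial>lebesgue)"
        using interior_subset[of K] by (intro nn_integral_mono) (auto simp: indicator_def)
      also have "\<dots> \<le> ennreal c * emeasure lebesgue (interior K)"
        using cubes[OF cube[OF K]] interior_eq[OF K] by simp
      finally show "emeasure (density lebesgue f) (interior K) \<le> \<dots>" .
    qed
    also have "\<dots> = ennreal c * emeasure lebesgue U"
      unfolding U_def
      by (subst nn_integral_cmult, simp, subst emeasure_UN_countable) (use D(1) disj in auto)
    also have "\<dots> \<le> ennreal c * emeasure lebesgue (A \<union> (T - A))"
    proof (intro mult_left_mono emeasure_mono)
      show "U \<subseteq> A \<union> (T - A)"
        using D(4) T(2) interior_subset unfolding U_def by fastforce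
      show "A \<union> (T - A) \<in> sets lebesgue"
        using A(1) fmeasurableD[OF T(3)] by (rule sets.Un)
    qed simp
    also have "\<dots> \<le> ennreal c * (emeasure lebesgue A + emeasure lebesgue (T - A))"
      using A(1) T(3) by (intro mult_left_mono emeasure_subadditive) (auto simp: fmeasurable_def)
    also have "\<dots> \<le> ennreal c * (emeasure lebesgue A + ennreal e)"
      using T(4) by (intro mult_left_mono add_left_mono) auto
    finally show ?thesis by (simp add: distrib_left)
  qed note approx = this
  show ?thesis
  proof (rule ennreal_le_epsilon)
    fix e :: real assume "0 < e"
    have "ennreal c * ennreal (e / (c + 1)) \<le> ennreal e"
      using \<open>0 < e\<close> \<open>0 \<le> c\<close> by (auto simp: ennreal_mult[symmetric] field_simps intro!: ennreal_leI)
    moreover have "0 < e / (c + 1)" using \<open>0 < e\<close> \<open>0 \<le> c\<close> by simp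
    ultimately show "(\<integral>\<^sup>+x\<in>A. f x \<partial>lebesgue) \<le> ennreal c * emeasure lebesgue A + ennreal e"
      using approx by (meson add_left_mono order_trans)
  qed
qed

text \<open>
  On the bounded parts of \<open>{x. f x > c}\<close> the integral of \<open>f - c\<close> is at most \<open>0\<close> although its
  integrand is positive, so that set is null.
\<close>

lemma AE_le_of_cubes:
  fixes f :: "'a::euclidean_space \<Rightarrow> real"
  assumes f: "f \<in> borel_measurable lebesgue" and "0 \<le> c"
    and cubes: "\<And>Q. is_cube Q \<Longrightarrow>
      (\<integral>\<^sup>+x\<in>Q. ennreal (f x) \<partial>lebesgue) \<le> ennreal c * emeasure lebesgue Q"
  shows "AE x in lebesgue. f x \<le> c"
proof -
  have "AE x in lebesgue. x \<in> ball 0 (real m) \<longrightarrow> f x \<le> c" for m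
  proof -
    define A where "A = {x. f x > c} \<inter> ball 0 (real m)"
    have "{x. f x > c} \<in> sets lebesgue"
      using borel_measurable_le f by (simp add: borel_measurable_iff_greater)
    then have A: "A \<in> sets lebesgue" "bounded A"
      unfolding A_def by (auto simp: bounded_Int)
    have fin: "emeasure lebesgue A \<noteq> \<infinity>"
      using fmeasurableD2[OF bounded_set_imp_lmeasurable[OF A(2,1)]] by simp
    let ?I = "\<integral>\<^sup>+x. ennreal (f x - c) * indicator A x \<partial>lebesgue"
    have "?I + ennreal c * emeasure lebesgue A = (\<integral>\<^sup>+x. ennreal (f x - c) * indicator A x + ennreal c * indicator A x \<partial>lebesgue)"
      using f A(1) by (subst nn_integral_add) (auto simp: nn_integral_cmult_indicator)
    also have "\<dots> = (\<integral>\<^sup>+x\<in>A. ennreal (f x) \<partial>lebesgue)"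
      using \<open>0 \<le> c\<close>
      by (intro nn_integral_cong) (auto simp: A_def indicator_def ennreal_plus[symmetric] simp del: ennreal_plus)
    also have "\<dots> \<le> 0 + ennreal c * emeasure lebesgue A"
      using nn_integral_bounded_set_le_of_cubes[OF _ \<open>0 \<le> c\<close> cubes A] f by simp
    finally have "ennreal c * emeasure lebesgue A + ?I \<le> ennreal c * emeasure lebesgue A + 0"
      by (simp only: add_0_left add_0_right add.commute)
    moreover have "ennreal c * emeasure lebesgue A \<noteq> \<infinity>"
      using fin by (auto simp: ennreal_mult_eq_top_iff)
    ultimately have "?I = 0"
      unfolding ennreal_add_left_cancel_le by simp
    then have "AE x in lebesgue. ennreal (f x - c) * indicator A x = 0"
      using f A(1) by (subst (asm) nn_integral_0_iff_AE) auto
    then show ?thesis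
      by eventually_elim (auto simp: A_def indicator_def split: if_splits)
  qed
  then have "AE x in lebesgue. \<forall>m. x \<in> ball 0 (real m) \<longrightarrow> f x \<le> c"
    by (subst AE_all_countable) blast
  then show ?thesis
    by eventually_elim (use reals_Archimedean2 in \<open>auto simp: dist_norm\<close>)
qed

section \<open>Nearest points in mean square\<close>

text \<open>
  The reals are not a complete lattice, so the limit inferior of a bounded sequence is taken in the
  explicit form \<open>SUP k. INF m\<in>{k..}. a m\<close>.
\<close>

lemma bounded_real_liminf:
  fixes a :: "nat \<Rightarrow> real"
  assumes lo: "\<And>n. 0 \<le> a n" and hi: "\<And>n. a n \<le> c"
  defines "I \<equiv> (\<lambda>k. INF m\<in>{k..}. a m)"
  shows INF_tail_le: "I k \<le> a k" and INF_tail_nonneg: "0 \<le> I k"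
    and INF_tail_incseq: "incseq I" and INF_tail_tendsto: "I \<longlonglongrightarrow> (SUP k. I k)"
    and SUP_INF_tail_eq: "a \<longlonglongrightarrow> L \<Longrightarrow> (SUP k. I k) = L"
proof -
  have bdd: "bdd_below (a ` {k..})" for k using lo by (auto simp: bdd_below_def)
  show le: "I k \<le> a k" for k unfolding I_def by (rule cINF_lower[OF bdd]) simp
  show "0 \<le> I k" for k unfolding I_def by (rule cINF_greatest) (auto simp: lo)
  show inc: "incseq I" unfolding incseq_def I_def
    by (intro allI impI cINF_superset_mono bdd) auto
  have "bdd_above (range I)" using le hi by (auto simp: bdd_above_def intro: order_trans)
  then show lim: "I \<longlonglongrightarrow> (SUP k. I k)" using inc by (rule LIMSEQ_incseq_SUP)
  assume a: "a \<longlonglongrightarrow> L"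
  have "L \<le> (SUP k. I k)"
  proof (rule field_le_epsilon)
    fix e :: real assume "0 < e"
    then obtain K where K: "\<And>m. K \<le> m \<Longrightarrow> \<bar>a m - L\<bar> < e"
      using a by (force simp: lim_sequentially dist_real_def)
    have "L - e \<le> I K" unfolding I_def by (rule cINF_greatest) (use K in fastforce)+
    also have "\<dots> \<le> (SUP k. I k)" by (rule incseq_le[OF inc lim])
    finally show "L \<le> (SUP k. I k) + e" by simp
  qed
  moreover have "(SUP k. I k) \<le> L" by (rule LIMSEQ_le[OF lim a]) (use le in auto)
  ultimately show "(SUP k. I k) = L" by simp
qed

lemma integrable_bounded_support:
  fixes f :: "'a \<Rightarrow> real"
  assumes "E \<in> sets M" "emeasure M E < \<infinity>" "f \<in> borel_measurable M"
    and "\<And>x. \<bar>f x\<bar> \<le> c * indicator E x"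
  shows "integrable M f"
proof (rule Bochner_Integration.integrable_bound)
  show "integrable M (\<lambda>x. c * indicator E x)" using assms by simp
  show "AE x in M. norm (f x) \<le> norm (c * indicator E x)"
    using assms(4) by (intro AE_I2) (simp, meson abs_ge_self order_trans)
qed fact

lemma AE_convergent_of_summable_increments:
  fixes P :: "nat \<Rightarrow> 'a \<Rightarrow> real"
  assumes meas: "\<And>n. P n \<in> borel_measurable M"
    and bound: "\<And>n. (\<integral>\<^sup>+x. ennreal \<bar>P (Suc n) x - P n x\<bar> \<partial>M) \<le> ennreal (c n)"
    and c: "\<And>n. 0 \<le> c n" "summable c"
  shows "AE x in M. convergent (\<lambda>n. P n x)"
proof -
  have "(\<integral>\<^sup>+x. (\<Sum>n. ennreal \<bar>P (Suc n) x - P n x\<bar>) \<partial>M)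
      = (\<Sum>n. \<integral>\<^sup>+x. ennreal \<bar>P (Suc n) x - P n x\<bar> \<partial>M)"
    using meas by (intro nn_integral_suminf) auto
  also have "\<dots> \<le> (\<Sum>n. ennreal (c n))"
    by (intro suminf_le bound) auto
  also have "\<dots> < \<infinity>"
    using ennreal_suminf_neq_top[OF c(2,1)] by (simp add: less_top)
  finally have "AE x in M. (\<Sum>n. ennreal \<bar>P (Suc n) x - P n x\<bar>) \<noteq> \<infinity>"
    using meas by (intro nn_integral_PInf_AE) auto
  then show ?thesis
  proof eventually_elim
    case (elim x)
    have "summable (\<lambda>n. P (Suc n) x - P n x)"
      by (rule summable_rabs_cancel, rule summable_suminf_not_top) (use elim in auto)
    then have "convergent (\<lambda>n. P 0 x + (\<Sum>i<n. P (Suc i) x - P i x))"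
      unfolding summable_iff_convergent by (intro convergent_add convergent_const)
    then show ?case
      by (simp add: sum_lessThan_telescope[of "\<lambda>i. P i x"])
  qed
qed

text \<open>
  The point of \<open>B\<close> nearest to the indicator in mean square.  The parallelogram
  identity bounds the mean square of an increment of a minimising sequence by the distances of its
  values from the infimum; if these decrease geometrically, the increments are summable in \<open>L\<^sup>1\<close> and
  the sequence converges almost everywhere.  Closedness is therefore only demanded for pointwise limits inferior, which is
  what the monotone convergence axiom of a function norm provides, and completeness of \<open>L\<^sup>2\<close> never
  enters.
\<close>

lemma least_squares_attained:
  fixes B :: "('a \<Rightarrow> real) set"
  assumes E: "E \<in> sets M" "emeasure M E < \<infinity>" and "B \<noteq> {}"
    and meas: "\<And>p. p \<in> B \<Longrightarrow> p \<in> borel_measurable M"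
    and lo: "\<And>p x. p \<in> B \<Longrightarrow> 0 \<le> p x" and hi: "\<And>p x. p \<in> B \<Longrightarrow> p x \<le> indicator E x"
    and mid: "\<And>p q. p \<in> B \<Longrightarrow> q \<in> B \<Longrightarrow> (\<lambda>x. (p x + q x) / 2) \<in> B"
    and closed: "\<And>P. (\<And>n::nat. P n \<in> B) \<Longrightarrow> (\<lambda>x. SUP k. INF m\<in>{k..}. P m x) \<in> B"
  shows "\<exists>p\<in>B. \<forall>q\<in>B. (LINT x|M. (indicator E x - p x)\<^sup>2) \<le> (LINT x|M. (indicator E x - q x)\<^sup>2)"
proof -
  define J where "J = (\<lambda>p. (LINT x|M. (indicator E x - p x)\<^sup>2) :: real)"
  define d where "d = (INF p\<in>B. J p)"
  have bdd: "bdd_below (J ` B)"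
    by (rule bdd_belowI[of _ 0]) (auto simp: J_def)
  have d_le: "d \<le> J p" if "p \<in> B" for p
    unfolding d_def using bdd that by (rule cINF_lower)
  have "\<exists>p\<in>B. J p < d + (1/4)^n" for n :: nat
    using cINF_less_iff[OF \<open>B \<noteq> {}\<close> bdd, of "d + (1/4)^n"] by (simp add: d_def)
  then obtain P where P: "\<And>n. P n \<in> B" "\<And>n. J (P n) < d + (1/4)^n"
    by metis
  have int_diff: "integrable M (\<lambda>x. (p x - q x)\<^sup>2)"
    if "p \<in> borel_measurable M" "q \<in> borel_measurable M"
      "\<And>x. 0 \<le> p x \<and> p x \<le> indicator E x" "\<And>x. 0 \<le> q x \<and> q x \<le> indicator E x" for p q :: "'a \<Rightarrow> real"
  proof (rule integrable_bounded_support[OF E, where c=1])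
    fix x
    have "\<bar>p x - q x\<bar> \<le> indicator E x" using that(3,4)[of x] by auto
    then show "\<bar>(p x - q x)\<^sup>2\<bar> \<le> 1 * indicator E x"
      by (cases "x \<in> E") (auto simp: abs_square_le_1)
  qed (use that in measurable)
  have ind: "(indicator E :: 'a \<Rightarrow> real) \<in> borel_measurable M" "\<And>x. 0 \<le> (indicator E x :: real) \<and> indicator E x \<le> (indicator E x :: real)"
    using E by auto
  have bdsP: "P n \<in> borel_measurable M" "\<And>x. 0 \<le> P n x \<and> P n x \<le> indicator E x" for n
    using P(1) meas lo hi by auto
  have increments: "(LINT x|M. (P (Suc n) x - P n x)\<^sup>2) \<le> 4 * (1/4)^n" for n
  proof -
    let ?m = "\<lambda>x. (P (Suc n) x + P n x) / 2"
    have m: "?m \<in> B" using P(1) mid by blast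
    have "(LINT x|M. (P (Suc n) x - P n x)\<^sup>2)
        = (LINT x|M. 2 * (indicator E x - P (Suc n) x)\<^sup>2 + 2 * (indicator E x - P n x)\<^sup>2
                     - 4 * (indicator E x - ?m x)\<^sup>2)"
      by (intro Bochner_Integration.integral_cong) (auto simp: power2_eq_square field_simps)
    also have "\<dots> = 2 * J (P (Suc n)) + 2 * J (P n) - 4 * J ?m"
      unfolding J_def using int_diff[OF ind(1) bdsP(1) ind(2) bdsP(2)]
        int_diff[OF ind(1) meas[OF m] ind(2)] lo[OF m] hi[OF m]
      by (simp del: divide_const_simps)
    also have "\<dots> \<le> 2 * (d + (1/4)^Suc n) + 2 * (d + (1/4)^n) - 4 * d"
      using P(2)[of n] P(2)[of "Suc n"] d_le[OF m]
      by (intro diff_mono add_mono mult_left_mono) auto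
    also have "\<dots> \<le> 4 * (1/4)^n" by simp
    finally show ?thesis .
  qed
  have int_abs: "integrable M (\<lambda>x. \<bar>P (Suc n) x - P n x\<bar>)" for n
  proof (rule integrable_bounded_support[OF E, where c=1])
    fix x show "\<bar>\<bar>P (Suc n) x - P n x\<bar>\<bar> \<le> 1 * indicator E x"
      using bdsP(2)[of "Suc n" x] bdsP(2)[of n x] by auto
  qed (use bdsP(1) in measurable)
  have "(\<integral>\<^sup>+x. ennreal \<bar>P (Suc n) x - P n x\<bar> \<partial>M) \<le> ennreal ((4 + measure M E) * (1/2)^n)" for n
  proof -
    \<comment> \<open>The inequality \<open>2 s \<le> 2^n s^2 + 2^(-n)\<close> turns the bound \<open>4 / 4^n\<close> on squares into a
      summable bound on the increments themselves.\<close>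
    have "\<bar>P (Suc n) x - P n x\<bar> \<le> 2^n * (P (Suc n) x - P n x)\<^sup>2 + (1/2)^n * indicator E x" for x
    proof (cases "x \<in> E")
      case True
      define s where "s = \<bar>P (Suc n) x - P n x\<bar>"
      have "0 \<le> (2^n * s - 1)\<^sup>2" by simp
      then have "2 * (2^n * s) \<le> 2^n * (2^n * s\<^sup>2) + 1"
        by (simp add: power2_eq_square algebra_simps)
      moreover have "0 \<le> 2^n * s" by (simp add: s_def)
      ultimately have "2^n * s \<le> 2^n * (2^n * s\<^sup>2 + (1/2)^n)"
        by (simp add: distrib_left power_divide)
      then have "s \<le> 2^n * s\<^sup>2 + (1/2)^n"
        using mult_le_cancel_left_pos[of "2^n :: real"] by simp
      then show ?thesis using True by (simp add: s_def)
    next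
      case False
      then show ?thesis using bdsP(2)[of "Suc n" x] bdsP(2)[of n x] by auto
    qed
    then have "(LINT x|M. \<bar>P (Suc n) x - P n x\<bar>)
        \<le> (LINT x|M. 2^n * (P (Suc n) x - P n x)\<^sup>2 + (1/2)^n * indicator E x)"
      using int_diff[OF bdsP(1) bdsP(1) bdsP(2) bdsP(2)] E int_abs
      by (intro integral_mono) auto
    also have "\<dots> = 2^n * (LINT x|M. (P (Suc n) x - P n x)\<^sup>2) + (1/2)^n * measure M E"
      using int_diff[OF bdsP(1) bdsP(1) bdsP(2) bdsP(2)] E by simp
    also have "\<dots> \<le> 2^n * (4 * (1/4)^n) + (1/2)^n * measure M E"
      using increments[of n] by (intro add_right_mono mult_left_mono) auto
    also have "\<dots> = (4 + measure M E) * (1/2)^n"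
    proof -
      have "(2::real)^n * (1/4)^n = (1/2)^n" by (simp flip: power_mult_distrib)
      then show ?thesis by (simp add: algebra_simps)
    qed
    finally show ?thesis
      using int_abs by (simp add: nn_integral_eq_integral ennreal_leI)
  qed
  then have conv: "AE x in M. convergent (\<lambda>n. P n x)"
    by (intro AE_convergent_of_summable_increments[OF bdsP(1)])
      (auto intro: summable_mult summable_geometric)
  define p where "p = (\<lambda>x. SUP k. INF m\<in>{k..}. P m x)"
  have p: "p \<in> B" unfolding p_def by (rule closed) (rule P)
  have lim: "AE x in M. (\<lambda>n. P n x) \<longlonglongrightarrow> p x"
    using conv
  proof eventually_elim
    case (elim x)
    then obtain L where L: "(\<lambda>n. P n x) \<longlonglongrightarrow> L" by (auto simp: convergent_def)
    then have "p x = L"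
      unfolding p_def using bdsP(2) by (intro SUP_INF_tail_eq[where c="indicator E x"]) auto
    then show ?case using L by simp
  qed
  have "(\<lambda>n. J (P n)) \<longlonglongrightarrow> J p"
    unfolding J_def
  proof (rule integral_dominated_convergence[where w="indicator E"])
    show "AE x in M. (\<lambda>n. (indicator E x - P n x)\<^sup>2) \<longlonglongrightarrow> (indicator E x - p x)\<^sup>2"
      using lim by eventually_elim (intro tendsto_intros)
    show "AE x in M. norm ((indicator E x - P n x)\<^sup>2) \<le> indicator E x" for n
    proof (intro AE_I2)
      fix x show "norm ((indicator E x - P n x)\<^sup>2) \<le> (indicator E x :: real)"
        using bdsP(2)[of n x] by (cases "x \<in> E") (auto simp: abs_square_le_1)
    qed
  qed (use E meas[OF p] bdsP(1) in auto)
  moreover have "(\<lambda>n. d + (1/4)^n) \<longlonglongrightarrow> d + 0"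
    by (intro tendsto_intros LIMSEQ_power_zero) simp
  ultimately have "J p \<le> d + 0"
    by (rule LIMSEQ_le) (use P(2) less_imp_le in blast)
  then show ?thesis using p d_le unfolding J_def by (intro bexI[of _ p]) force+
qed

section \<open>Bounded functions in a ball Banach function space\<close>

text \<open>
  The sum counts the integers in \<open>{1..m}\<close> below \<open>m * y\<close>, so this is rounding down to a multiple of
  \<open>1 / m\<close>.  Read with \<open>y = f x\<close>, it approximates \<open>f\<close> uniformly by sums of indicators of its
  superlevel sets.
\<close>

lemma layer_average_close:
  fixes y :: real
  assumes "0 \<le> y" "y \<le> 1" "0 < m"
  shows "\<bar>(1 / real m) * (\<Sum>j\<in>{1..m}. of_bool (real j \<le> real m * y)) - y\<bar> \<le> 1 / real m"
proof -
  have my: "0 \<le> real m * y" "real m * y \<le> real m"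
    using assms by (auto simp: mult_left_le)
  have "{j \<in> {1..m}. real j \<le> real m * y} = {1..nat \<lfloor>real m * y\<rfloor>}"
  proof (rule set_eqI)
    fix j
    have "real j \<le> real m * y \<longleftrightarrow> j \<le> nat \<lfloor>real m * y\<rfloor>"
      using my by (simp add: le_nat_floor le_nat_iff le_floor_iff)
    moreover have "real j \<le> real m * y \<Longrightarrow> j \<le> m" using my by linarith
    ultimately show "j \<in> {j \<in> {1..m}. real j \<le> real m * y} \<longleftrightarrow> j \<in> {1..nat \<lfloor>real m * y\<rfloor>}"
      by auto
  qed
  then have "(\<Sum>j\<in>{1..m}. of_bool (real j \<le> real m * y)) = real (nat \<lfloor>real m * y\<rfloor>)"
    by (simp add: of_bool_def sum.If_cases Int_def)
  moreover have "\<bar>real (nat \<lfloor>real m * y\<rfloor>) - real m * y\<bar> \<le> 1"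
    using my by linarith
  moreover have "\<bar>(1 / real m) * z - y\<bar> = \<bar>z - real m * y\<bar> / real m" for z
    using \<open>0 < m\<close> by (simp add: field_simps abs_mult[symmetric] abs_divide[symmetric] flip: abs_of_pos)
  ultimately show ?thesis by (simp add: divide_right_mono)
qed

lemma emeasure_bounded: "bounded E \<Longrightarrow> E \<in> sets lebesgue \<Longrightarrow> emeasure lebesgue E < \<infinity>"
  using fmeasurableD2[OF bounded_set_imp_lmeasurable[of E]] by (simp add: less_top del: emeasure_completion)

context ball_Banach_function_space
begin

lemma zero_closed: "(\<lambda>x. 0) \<in> X"
  using scale_closed[OF indicator_closed[of "{}"], of 0] by simp

lemma norm_zero: "N (\<lambda>x. 0) = 0"
  using norm_scale[OF zero_closed, of 0] by simp

lemma norm_nonneg: "f \<in> X \<Longrightarrow> 0 \<le> N f"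
  using norm_mono[OF zero_closed, of f] by (simp add: norm_zero)

lemma diff_closed: "f \<in> X \<Longrightarrow> g \<in> X \<Longrightarrow> (\<lambda>x. f x - g x) \<in> X"
  using add_closed[of f "\<lambda>x. (-1) * g x"] scale_closed[of g "-1"] by simp

lemma sum_closed: "(\<And>i. i \<in> I \<Longrightarrow> f i \<in> X) \<Longrightarrow> (\<lambda>x. \<Sum>i\<in>I. f i x) \<in> X"
  by (induction I rule: infinite_finite_induct) (auto simp: zero_closed add_closed)

lemma norm_cong_AE:
  assumes "f \<in> X" "g \<in> X" "AE x in lebesgue. f x = g x"
  shows "N f = N g"
proof (rule antisym)
  show "N f \<le> N g"
    by (rule norm_mono[OF assms(1,2)]) (use assms(3) in eventually_elim, simp)
  show "N g \<le> N f"
    by (rule norm_mono[OF assms(2,1)]) (use assms(3) in eventually_elim, simp)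
qed

text \<open>
  Membership in \<open>X\<close> does not pass to smaller functions by the axioms alone.  For bounded functions
  of bounded support it follows from completeness: the averages \<open>F n\<close> of indicators of superlevel
  sets converge uniformly to \<open>f\<close> on \<open>E\<close>, hence are a Cauchy sequence for \<open>N\<close>, and the local
  integral bound identifies their limit in \<open>X\<close> with \<open>f\<close>.
\<close>

lemma below_indicator_closed:
  assumes E: "bounded E" "E \<in> sets lebesgue" and f: "f \<in> borel_measurable lebesgue"
    and f01: "\<And>x. 0 \<le> f x" "\<And>x. f x \<le> indicator E x"
  shows "f \<in> X"
proof -
  define F where "F n x = (1 / real (Suc n)) *
    (\<Sum>j\<in>{1..Suc n}. indicat_real {x. real j \<le> real (Suc n) * f x} x)" for n x
  have "{x. real j \<le> real (Suc n) * f x} \<subseteq> E" if "j \<in> {1..Suc n}" for j n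
  proof
    fix x assume x: "x \<in> {x. real j \<le> real (Suc n) * f x}"
    show "x \<in> E"
    proof (rule ccontr)
      assume "x \<notin> E"
      then have "f x = 0" using f01[of x] by simp
      then show False using x that by simp
    qed
  qed
  moreover have "{x. real j \<le> real (Suc n) * f x} \<in> sets lebesgue" for j n
  proof -
    have "{x \<in> space lebesgue. real j \<le> real (Suc n) * f x} \<in> sets lebesgue"
      using f by measurable
    then show ?thesis by simp
  qed
  ultimately have layer: "indicat_real {x. real j \<le> real (Suc n) * f x} \<in> X" if "j \<in> {1..Suc n}" for j n
    using indicator_closed bounded_subset[OF E(1)] that by metis
  have F: "F n \<in> X" for n
    unfolding F_def by (rule scale_closed, rule sum_closed, rule layer)
  have Ff: "\<bar>F n x - f x\<bar> \<le> (1 / real (Suc n)) * indicator E x" for n x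
  proof (cases "x \<in> E")
    case True
    have "F n x = (1 / real (Suc n)) * (\<Sum>j\<in>{1..Suc n}. of_bool (real j \<le> real (Suc n) * f x))"
      unfolding F_def by (simp add: indicator_def)
    then show ?thesis
      using layer_average_close[of "f x" "Suc n"] f01[of x] True by simp
  next
    case False
    then have "f x = 0" using f01[of x] by simp
    then show ?thesis using False by (simp add: F_def indicator_def)
  qed
  define c where "c = N (indicat_real E)"
  have c: "0 \<le> c" unfolding c_def by (intro norm_nonneg indicator_closed E)
  have dist: "N (\<lambda>x. F i x - F j x) \<le> (1 / real (Suc i) + 1 / real (Suc j)) * c" for i j
  proof -
    let ?s = "1 / real (Suc i) + 1 / real (Suc j)"
    have "N (\<lambda>x. F i x - F j x) \<le> N (\<lambda>x. ?s * indicat_real E x)"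
    proof (intro norm_mono diff_closed scale_closed F indicator_closed E AE_I2)
      fix x
      have "\<bar>F i x - F j x\<bar> \<le> ?s * indicat_real E x"
        using Ff[of i x] Ff[of j x] by (simp add: distrib_right)
      then show "\<bar>F i x - F j x\<bar> \<le> \<bar>?s * indicat_real E x\<bar>" by linarith
    qed
    also have "\<dots> = ?s * c"
      using norm_scale[OF indicator_closed[OF E], of ?s] by (simp add: c_def)
    finally show ?thesis .
  qed
  have "\<exists>K. \<forall>i\<ge>K. \<forall>j\<ge>K. N (\<lambda>x. F i x - F j x) < e" if "0 < e" for e
  proof -
    obtain K where K: "1 / real (Suc K) < e / (c + 1) / 2"
      using reals_Archimedean[of "e / (c + 1) / 2"] \<open>0 < e\<close> c by (auto simp: inverse_eq_divide)
    have "N (\<lambda>x. F i x - F j x) < e" if "K \<le> i" "K \<le> j" for i j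
    proof -
      have "1 / real (Suc i) \<le> 1 / real (Suc K)" "1 / real (Suc j) \<le> 1 / real (Suc K)"
        using that by (simp_all add: frac_le)
      then have "1 / real (Suc i) + 1 / real (Suc j) \<le> e / (c + 1) / 2 + e / (c + 1) / 2"
        using less_imp_le[OF K] by (meson add_mono order_trans)
      then have "1 / real (Suc i) + 1 / real (Suc j) \<le> e / (c + 1)"
        by (simp only: field_sum_of_halves)
      then have "N (\<lambda>x. F i x - F j x) \<le> e / (c + 1) * c"
        using dist[of i j] c by (meson mult_right_mono order_trans)
      also have "\<dots> < e" using \<open>0 < e\<close> c by (simp add: field_simps)
      finally show ?thesis .
    qed
    then show ?thesis by blast
  qed
  from complete[OF F this] obtain g where g: "g \<in> X" "(\<lambda>k. N (\<lambda>x. F k x - g x)) \<longlonglongrightarrow> 0"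
    by blast
  have "AE x in lebesgue. x \<in> ball 0 (real m) \<longrightarrow> f x = g x" for m
  proof -
    let ?D = "ball 0 (real m) :: 'a set"
    have D: "bounded ?D" "?D \<in> sets lebesgue" by auto
    obtain C where C: "\<And>f. f \<in> X \<Longrightarrow> (\<integral>\<^sup>+x\<in>?D. ennreal \<bar>f x\<bar> \<partial>lebesgue) \<le> ennreal (C * N f)"
      using local_integral_bound[OF D] by blast
    have meas: "(\<lambda>x. ennreal \<bar>h x\<bar> * indicator ?D x) \<in> borel_measurable lebesgue"
      if "h \<in> borel_measurable lebesgue" for h :: "'a \<Rightarrow> real"
      by (intro borel_measurable_times_ennreal borel_measurable_indicator D(2) measurable_compose[OF _ measurable_ennreal] borel_measurable_abs that)
    have fin: "emeasure lebesgue E = ennreal (measure lebesgue E)"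
      using emeasure_bounded[OF E] by (simp add: emeasure_eq_ennreal_measure less_top del: emeasure_completion)
    have "(\<integral>\<^sup>+x\<in>?D. ennreal \<bar>f x - g x\<bar> \<partial>lebesgue)
        \<le> ennreal (C * N (\<lambda>x. F k x - g x)) + ennreal ((1 / real (Suc k)) * measure lebesgue E)" for k
    proof -
      have "(\<integral>\<^sup>+x\<in>?D. ennreal \<bar>f x - g x\<bar> \<partial>lebesgue)
        \<le> (\<integral>\<^sup>+x. ennreal \<bar>F k x - g x\<bar> * indicator ?D x + ennreal (1 / real (Suc k)) * indicator E x \<partial>lebesgue)"
      proof (rule nn_integral_mono)
        fix x
        have "ennreal \<bar>f x - g x\<bar> \<le> ennreal (\<bar>F k x - g x\<bar> + (1 / real (Suc k)) * indicator E x)"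
          using Ff[of k x] by (intro ennreal_leI) linarith
        also have "\<dots> = ennreal \<bar>F k x - g x\<bar> + ennreal (1 / real (Suc k)) * indicator E x"
          by (subst ennreal_plus) (auto simp: indicator_def)
        finally show "ennreal \<bar>f x - g x\<bar> * indicator ?D x
            \<le> ennreal \<bar>F k x - g x\<bar> * indicator ?D x + ennreal (1 / real (Suc k)) * indicator E x"
          by (cases "x \<in> ?D") auto
      qed
      also have "\<dots> = (\<integral>\<^sup>+x\<in>?D. ennreal \<bar>F k x - g x\<bar> \<partial>lebesgue) + ennreal (1 / real (Suc k)) * emeasure lebesgue E"
        using meas[OF measurable[OF diff_closed[OF F g(1)]]] E(2)
        by (subst nn_integral_add) (auto simp: nn_integral_cmult_indicator simp del: emeasure_completion)
      also have "\<dots> \<le> ennreal (C * N (\<lambda>x. F k x - g x)) + ennreal (1 / real (Suc k)) * emeasure lebesgue E"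
        by (intro add_right_mono C diff_closed F g)
      finally show ?thesis by (simp only: fin) (subst ennreal_mult, auto)
    qed
    moreover have "(\<lambda>k. ennreal (C * N (\<lambda>x. F k x - g x)) + ennreal ((1 / real (Suc k)) * measure lebesgue E))
        \<longlonglongrightarrow> ennreal (C * 0) + ennreal (0 * measure lebesgue E)"
      using LIMSEQ_inverse_real_of_nat
      by (intro tendsto_add tendsto_ennrealI tendsto_mult tendsto_const g) (simp add: inverse_eq_divide)
    ultimately have "(\<integral>\<^sup>+x\<in>?D. ennreal \<bar>f x - g x\<bar> \<partial>lebesgue) \<le> ennreal (C * 0) + ennreal (0 * measure lebesgue E)"
      by (intro LIMSEQ_le_const) auto
    then have "(\<integral>\<^sup>+x\<in>?D. ennreal \<bar>f x - g x\<bar> \<partial>lebesgue) = 0" by simp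
    then have "AE x in lebesgue. ennreal \<bar>f x - g x\<bar> * indicator ?D x = 0"
      using meas[OF borel_measurable_diff[OF f measurable[OF g(1)]]] by (subst (asm) nn_integral_0_iff_AE) auto
    then show ?thesis by eventually_elim (auto simp: indicator_def)
  qed
  then have "AE x in lebesgue. \<forall>m. x \<in> ball 0 (real m) \<longrightarrow> f x = g x"
    by (subst AE_all_countable) blast
  then have "AE x in lebesgue. f x = g x"
    by eventually_elim (use reals_Archimedean2 in \<open>auto simp: dist_norm\<close>)
  then show ?thesis using AE_closed[OF g(1) f] by simp
qed

lemma bounded_function_closed:
  assumes E: "bounded E" "E \<in> sets lebesgue" and f: "f \<in> borel_measurable lebesgue"
    and f0: "\<And>x. 0 \<le> f x" "\<And>x. f x \<le> c * indicator E x" and "0 < c"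
  shows "f \<in> X"
proof -
  have "(\<lambda>x. (1 / c) * f x) \<in> X"
    by (rule below_indicator_closed[OF E]) (use assms in \<open>auto simp: field_simps\<close>)
  from scale_closed[OF this, of c] show ?thesis using \<open>0 < c\<close> by simp
qed

section \<open>Norming functions for indicators\<close>

text \<open>
  The tail infima stay below the members of the sequence and increase to the limit inferior, which
  is again below the indicator and so belongs to \<open>X\<close>; the monotone convergence axiom applies.
\<close>

lemma liminf_norm_le:
  assumes E: "bounded E" "E \<in> sets lebesgue"
    and P: "\<And>n::nat. P n \<in> borel_measurable lebesgue"
      "\<And>n x. 0 \<le> P n x" "\<And>n x. P n x \<le> indicator E x" "\<And>n. N (P n) \<le> r"
  defines "p \<equiv> (\<lambda>x. SUP k. INF m\<in>{k..}. P m x)"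
  shows "p \<in> borel_measurable lebesgue" "0 \<le> p x" "p x \<le> indicator E x" "N p \<le> r"
proof -
  define I where "I = (\<lambda>k x. INF m\<in>{k..}. P m x)"
  have I_lim: "(\<lambda>k. I k x) \<longlonglongrightarrow> p x" for x
    unfolding I_def p_def using P(2,3) by (rule INF_tail_tendsto)
  have I_inc: "incseq (\<lambda>k. I k x)" for x
    unfolding I_def using P(2,3) by (rule INF_tail_incseq)
  have I_le: "I k x \<le> P k x" for k x
    unfolding I_def using P(2,3) by (rule INF_tail_le)
  have I_nonneg: "0 \<le> I k x" for k x
    unfolding I_def using P(2,3) by (rule INF_tail_nonneg)
  have I_meas: "I k \<in> borel_measurable lebesgue" for k
    unfolding I_def using P(1,2) by (intro borel_measurable_cINF) (auto simp: bdd_below_def)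
  show p: "p \<in> borel_measurable lebesgue"
    by (rule borel_measurable_LIMSEQ_real[OF I_lim I_meas])
  show p_nonneg: "0 \<le> p x" for x
    by (rule LIMSEQ_le_const[OF I_lim]) (use I_nonneg in auto)
  show p_le: "p x \<le> indicator E x" for x
    by (rule LIMSEQ_le_const2[OF I_lim]) (use I_le P(3) in \<open>blast intro: order_trans\<close>)
  have P_X: "P k \<in> X" for k
    by (rule below_indicator_closed[OF E P(1-3)])
  have I_X: "I k \<in> X" for k
    by (rule below_indicator_closed[OF E I_meas I_nonneg]) (use I_le P(3) in \<open>blast intro: order_trans\<close>)
  have p_X: "p \<in> X"
    by (rule below_indicator_closed[OF E p p_nonneg p_le])
  have "(\<lambda>k. N (I k)) \<longlonglongrightarrow> N p"
    using norm_Fatou[OF I_X p_X] I_inc I_lim I_nonneg p_nonneg by simp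
  moreover have "N (I k) \<le> r" for k
    using norm_mono[OF I_X P_X, of k k] I_nonneg I_le P(2,4) by (simp add: order_trans[OF _ P(4)])
  ultimately show "N p \<le> r"
    by (intro LIMSEQ_le_const2) auto
qed

lemma norm_convex_combination:
  assumes "f \<in> X" "g \<in> X" "N f \<le> r" "N g \<le> r" "0 \<le> t" "t \<le> 1"
  shows "N (\<lambda>x. (1 - t) * f x + t * g x) \<le> r"
proof -
  have "N (\<lambda>x. (1 - t) * f x + t * g x) \<le> N (\<lambda>x. (1 - t) * f x) + N (\<lambda>x. t * g x)"
    by (intro norm_triangle scale_closed assms)
  also have "\<dots> = (1 - t) * N f + t * N g"
    using assms by (simp add: norm_scale)
  also have "\<dots> \<le> (1 - t) * r + t * r"
    using assms by (intro add_mono mult_left_mono) auto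
  finally show ?thesis by (simp add: algebra_simps)
qed

text \<open>
  The variational inequality for the nearest point \<open>p\<close> of the convex set of functions between \<open>0\<close>
  and the indicator with norm at most \<open>r\<close>.  The competitor \<open>f\<close> may exceed \<open>1\<close>: cutting
  \<open>(1 - t) p + t f\<close> down to height \<open>1\<close> neither raises its norm nor moves it away from the indicator.
  It is this freedom that makes \<open>indicator E - p\<close> a functional controlled on all of \<open>X\<close> and not only on
  the convex set.
\<close>

lemma projection_of_indicator:
  assumes E: "bounded E" "E \<in> sets lebesgue" and "0 \<le> r"
  obtains p where "p \<in> borel_measurable lebesgue" "\<And>x. 0 \<le> p x" "\<And>x. p x \<le> indicator E x" "N p \<le> r"
    and "\<forall>f c. f \<in> borel_measurable lebesgue \<longrightarrow> (\<forall>x. 0 \<le> f x \<and> f x \<le> c * indicator E x) \<longrightarrow> 0 < c \<longrightarrow> N f \<le> r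
      \<longrightarrow> (LINT x|lebesgue. (indicator E x - p x) * f x) \<le> (LINT x|lebesgue. (indicator E x - p x) * p x)"
proof -
  define B where "B = {p \<in> borel_measurable lebesgue. (\<forall>x. 0 \<le> p x \<and> p x \<le> indicat_real E x) \<and> N p \<le> r}"
  have B_X: "p \<in> X" if "p \<in> B" for p
    using that by (intro below_indicator_closed[OF E]) (auto simp: B_def)
  have fin: "emeasure lebesgue E < \<infinity>" by (rule emeasure_bounded[OF E])
  have "\<exists>p\<in>B. \<forall>q\<in>B. (LINT x|lebesgue. (indicator E x - p x)\<^sup>2) \<le> (LINT x|lebesgue. (indicator E x - q x)\<^sup>2)"
  proof (rule least_squares_attained[OF E(2) fin])
    show "B \<noteq> {}"
      using \<open>0 \<le> r\<close> norm_zero by (auto simp: B_def intro!: exI[of _ "\<lambda>x. 0"])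
    show "(\<lambda>x. (p x + q x) / 2) \<in> B" if "p \<in> B" "q \<in> B" for p q
    proof -
      have "(\<lambda>x. (p x + q x) / 2) = (\<lambda>x. (1 - 1/2) * p x + 1/2 * q x)"
        by (auto simp: field_simps)
      moreover have "N (\<lambda>x. (1 - 1/2) * p x + 1/2 * q x) \<le> r"
        by (rule norm_convex_combination) (use that B_X in \<open>auto simp: B_def\<close>)
      ultimately have "N (\<lambda>x. (p x + q x) / 2) \<le> r" by simp
      moreover have "(p x + q x) / 2 \<le> indicat_real E x" for x
        using that by (simp add: B_def) (smt (verit) field_sum_of_halves)
      ultimately show ?thesis using that by (auto simp: B_def)
    qed
    show "(\<lambda>x. SUP k. INF m\<in>{k..}. P m x) \<in> B" if "\<And>n::nat. P n \<in> B" for P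
      using liminf_norm_le[OF E, of P r] that by (auto simp: B_def)
  qed (auto simp: B_def)
  then obtain p where "p \<in> B" and least: "\<And>q. q \<in> B \<Longrightarrow>
      (LINT x|lebesgue. (indicator E x - p x)\<^sup>2) \<le> (LINT x|lebesgue. (indicator E x - q x)\<^sup>2)"
    by blast
  then have p: "p \<in> borel_measurable lebesgue" "\<And>x. 0 \<le> p x" "\<And>x. p x \<le> indicator E x" "N p \<le> r"
    by (auto simp: B_def)
  define g where "g = (\<lambda>x. indicat_real E x - p x)"
  have g: "g \<in> borel_measurable lebesgue" "\<And>x. 0 \<le> g x" "\<And>x. g x \<le> indicator E x"
    using p E(2) by (auto simp: g_def)
  have "(LINT x|lebesgue. g x * f x) \<le> (LINT x|lebesgue. g x * p x)"
    if f: "f \<in> borel_measurable lebesgue" "\<And>x. 0 \<le> f x" "\<And>x. f x \<le> c * indicator E x" "0 < c" "N f \<le> r" for f c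
  proof -
    have f_X: "f \<in> X" by (rule bounded_function_closed[OF E f(1-4)])
    have off: "f x = 0" "p x = 0" "g x = 0" if "x \<notin> E" for x
      using f(2,3)[of x] p(2,3)[of x] that by (auto simp: g_def)
    have fp: "\<bar>f x\<bar> \<le> c" "\<bar>p x\<bar> \<le> 1" and bd: "\<bar>f x - p x\<bar> \<le> c + 1" "\<bar>g x\<bar> \<le> 1" for x
    proof -
      have "indicat_real E x \<le> 1" by (simp add: indicator_def)
      then have "f x \<le> c" "p x \<le> 1" "g x \<le> 1"
        using f(3)[of x] p(3)[of x] g(3)[of x] mult_left_mono[of "indicat_real E x" 1 c] f(4)
        by linarith+
      then show "\<bar>f x\<bar> \<le> c" "\<bar>p x\<bar> \<le> 1" "\<bar>f x - p x\<bar> \<le> c + 1" "\<bar>g x\<bar> \<le> 1"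
        using f(2)[of x] p(2)[of x] g(2)[of x] by simp_all
    qed
    have int: "integrable lebesgue (\<lambda>x. (g x)\<^sup>2)" "integrable lebesgue (\<lambda>x. g x * (f x - p x))"
      "integrable lebesgue (\<lambda>x. (f x - p x)\<^sup>2)" "integrable lebesgue (\<lambda>x. g x * f x)" "integrable lebesgue (\<lambda>x. g x * p x)"
    proof -
      have base: "integrable lebesgue (\<lambda>x. h x * k x)"
        if "h \<in> borel_measurable lebesgue" "k \<in> borel_measurable lebesgue"
          "\<And>x. x \<notin> E \<Longrightarrow> h x = 0" "\<And>x. \<bar>h x\<bar> \<le> C" "\<And>x. \<bar>k x\<bar> \<le> D" for h k :: "'a \<Rightarrow> real" and C D
      proof (rule integrable_bounded_support[OF E(2) fin, where c="C * D"])
        fix x show "\<bar>h x * k x\<bar> \<le> C * D * indicator E x"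
          using that(3)[of x] mult_mono[OF that(4,5)[of x]] abs_ge_zero[of "h x"] that(4)[of x]
          by (cases "x \<in> E") (auto simp: abs_mult)
      qed (use that in auto)
      show "integrable lebesgue (\<lambda>x. (g x)\<^sup>2)"
        unfolding power2_eq_square by (rule base[where C = 1 and D = 1]) (use g(1) bd off in auto)
      show "integrable lebesgue (\<lambda>x. g x * (f x - p x))"
        by (rule base[where C = 1 and D = "c + 1"]) (use f(1) p(1) g(1) bd off in auto)
      show "integrable lebesgue (\<lambda>x. (f x - p x)\<^sup>2)"
        unfolding power2_eq_square
        by (rule base[where C = "c + 1" and D = "c + 1"]) (use f(1) p(1) bd off in auto)
      show "integrable lebesgue (\<lambda>x. g x * f x)"
        by (rule base[where C = 1 and D = c]) (use f(1) g(1) bd fp off in auto)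
      show "integrable lebesgue (\<lambda>x. g x * p x)"
        by (rule base[where C = 1 and D = 1]) (use p(1) g(1) bd fp off in auto)
    qed
    define a where "a = (LINT x|lebesgue. g x * (f x - p x))"
    define d where "d = (LINT x|lebesgue. (f x - p x)\<^sup>2)"
    have "0 \<le> d" unfolding d_def by simp
    have "2 * a \<le> t * d" if t: "0 < t" "t \<le> 1" for t
    proof -
      define s where "s = (\<lambda>x. (1 - t) * p x + t * f x)"
      define q where "q = (\<lambda>x. min 1 (s x))"
      have s: "s \<in> X" "\<And>x. 0 \<le> s x" "s \<in> borel_measurable lebesgue"
        unfolding s_def using f p t by (auto intro!: add_closed scale_closed f_X B_X[OF \<open>p \<in> B\<close>])
      have "N s \<le> r"
        unfolding s_def using t f p by (intro norm_convex_combination B_X[OF \<open>p \<in> B\<close>] f_X) auto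
      have q: "q \<in> borel_measurable lebesgue" "\<And>x. 0 \<le> q x" "\<And>x. q x \<le> indicator E x"
      proof -
        show "q x \<le> indicator E x" for x
          using off[of x] by (cases "x \<in> E") (auto simp: q_def s_def)
      qed (use s in \<open>auto simp: q_def\<close>)
      have "N q \<le> N s"
        by (rule norm_mono[OF below_indicator_closed[OF E q] s(1)]) (use s(2) in \<open>auto simp: q_def\<close>)
      then have "q \<in> B" using q \<open>N s \<le> r\<close> by (auto simp: B_def)
      have "(LINT x|lebesgue. (g x)\<^sup>2) \<le> (LINT x|lebesgue. (indicator E x - q x)\<^sup>2)"
        using least[OF \<open>q \<in> B\<close>] by (simp add: g_def)
      also have "\<dots> \<le> (LINT x|lebesgue. (g x)\<^sup>2 - 2 * t * (g x * (f x - p x)) + t\<^sup>2 * (f x - p x)\<^sup>2)"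
      proof (rule integral_mono)
        show "integrable lebesgue (\<lambda>x. (indicator E x - q x)\<^sup>2)"
        proof (rule integrable_bounded_support[OF E(2) fin, where c=1])
          fix x show "\<bar>(indicator E x - q x)\<^sup>2\<bar> \<le> 1 * indicator E x"
            using q(2,3)[of x] by (cases "x \<in> E") (auto simp: abs_square_le_1)
        qed (use q(1) E(2) in auto)
        show "integrable lebesgue (\<lambda>x. (g x)\<^sup>2 - 2 * t * (g x * (f x - p x)) + t\<^sup>2 * (f x - p x)\<^sup>2)"
          using int by simp
        fix x
        have "(indicator E x - q x)\<^sup>2 \<le> (indicator E x - s x)\<^sup>2"
        proof (cases "x \<in> E")
          case True
          then show ?thesis by (cases "s x \<le> 1") (auto simp: q_def)
        next
          case False
          then show ?thesis using off[OF False] by (simp add: q_def s_def)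
        qed
        also have "\<dots> = (g x)\<^sup>2 - 2 * t * (g x * (f x - p x)) + t\<^sup>2 * (f x - p x)\<^sup>2"
          by (simp add: g_def s_def power2_eq_square algebra_simps)
        finally show "(indicator E x - q x)\<^sup>2 \<le> \<dots>" .
      qed
      also have "\<dots> = (LINT x|lebesgue. (g x)\<^sup>2) - 2 * t * a + t\<^sup>2 * d"
        using int by (simp add: a_def d_def)
      finally have "t * (2 * a) \<le> t * (t * d)" by (simp add: power2_eq_square)
      then show ?thesis using t(1) by simp
    qed note small = this
    \<comment> \<open>Letting \<open>t\<close> tend to \<open>0\<close>.\<close>
    have "a \<le> 0"
    proof (rule ccontr)
      assume "\<not> a \<le> 0"
      define t where "t = min 1 (a / (d + 1))"
      have t: "0 < t" "t \<le> 1" "t \<le> a / (d + 1)"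
        using \<open>\<not> a \<le> 0\<close> \<open>0 \<le> d\<close> by (auto simp: t_def)
      have "2 * a \<le> a / (d + 1) * d"
        using small[OF t(1,2)] mult_right_mono[OF t(3) \<open>0 \<le> d\<close>] by linarith
      also have "\<dots> \<le> a"
        using \<open>\<not> a \<le> 0\<close> \<open>0 \<le> d\<close> by (simp add: field_simps)
      finally show False using \<open>\<not> a \<le> 0\<close> by simp
    qed
    moreover have "a = (LINT x|lebesgue. g x * f x) - (LINT x|lebesgue. g x * p x)"
      unfolding a_def right_diff_distrib using int(4,5) by simp
    ultimately show ?thesis by simp
  qed
  then show thesis using that[OF p] unfolding g_def by blast
qed

text \<open>
  The part of the Lorentz-Luxemburg theorem \<open>X'' = X\<close> that concerns indicators: the norm of the
  indicator is recovered, up to a factor as close to \<open>1\<close> as desired, by pairing it with a function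
  \<open>g\<close> of the associate space.  The function is \<open>g = indicator E - p\<close> with \<open>p\<close> the projection.  Since
  \<open>0 \<le> p \<le> 1\<close>, the variational inequality bounds the pairing of \<open>g\<close> with functions of norm at
  most \<open>r\<close> by the integral of \<open>g\<close>, and \<open>g\<close> does not vanish because the norm of \<open>p\<close> is smaller than that of the
  indicator.
\<close>

lemma norming_function:
  assumes E: "bounded E" "E \<in> sets lebesgue" and r: "0 < r" "r < N (indicat_real E)"
  obtains g where "g \<in> borel_measurable lebesgue" "\<And>x. 0 \<le> g x" "\<And>x. g x \<le> indicator E x"
    "0 < (LINT x|lebesgue. g x)"
    "ennreal r * assoc_norm X N (\<lambda>x. ennreal (g x)) \<le> ennreal (LINT x|lebesgue. g x)"
proof -
  obtain p where p: "p \<in> borel_measurable lebesgue" "\<And>x. 0 \<le> p x" "\<And>x. p x \<le> indicator E x" "N p \<le> r"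
    and dual: "\<forall>f c. f \<in> borel_measurable lebesgue \<longrightarrow> (\<forall>x. 0 \<le> f x \<and> f x \<le> c * indicator E x) \<longrightarrow> 0 < c \<longrightarrow> N f \<le> r
      \<longrightarrow> (LINT x|lebesgue. (indicator E x - p x) * f x) \<le> (LINT x|lebesgue. (indicator E x - p x) * p x)"
    by (rule projection_of_indicator[OF E less_imp_le[OF r(1)]]) (rule that)
  have fin: "emeasure lebesgue E < \<infinity>" by (rule emeasure_bounded[OF E])
  define g where "g = (\<lambda>x. indicat_real E x - p x)"
  have g: "g \<in> borel_measurable lebesgue" "\<And>x. 0 \<le> g x" "\<And>x. g x \<le> indicator E x"
    using p E(2) by (auto simp: g_def)
  define \<alpha> where "\<alpha> = (LINT x|lebesgue. g x * p x)"
  have g_int: "integrable lebesgue g"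
    by (rule integrable_bounded_support[OF E(2) fin g(1), where c=1]) (use g in auto)
  have p1: "p x \<le> 1" for x by (rule order_trans[OF p(3)]) simp
  have gp_int: "integrable lebesgue (\<lambda>x. g x * p x)"
  proof (rule Bochner_Integration.integrable_bound[OF g_int])
    show "AE x in lebesgue. norm (g x * p x) \<le> norm (g x)"
      using g(2) p(2) p1 by (intro AE_I2) (simp add: abs_mult mult_left_le)
  qed (use g p in auto)
  have "\<alpha> \<le> (LINT x|lebesgue. g x)"
    unfolding \<alpha>_def using g(2) p(2) p1 by (intro integral_mono gp_int g_int) (simp add: mult_left_le)
  have "0 < (LINT x|lebesgue. g x)"
  proof (rule ccontr)
    assume "\<not> 0 < (LINT x|lebesgue. g x)"
    moreover have "0 \<le> (LINT x|lebesgue. g x)"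
      using g(2) by (simp add: Bochner_Integration.integral_nonneg)
    ultimately have "(LINT x|lebesgue. g x) = 0" by simp
    then have "AE x in lebesgue. g x = 0"
      using integral_nonneg_eq_0_iff_AE[OF g_int] g(2) by simp
    then have "AE x in lebesgue. p x = indicator E x"
      by eventually_elim (simp add: g_def)
    then have "N p = N (indicat_real E)"
      by (intro norm_cong_AE below_indicator_closed[OF E p(1-3)] indicator_closed E)
    then show False using p(4) r(2) by simp
  qed
  moreover have "ennreal r * assoc_norm X N (\<lambda>x. ennreal (g x)) \<le> ennreal (LINT x|lebesgue. g x)"
  proof -
    have "(\<integral>\<^sup>+x. ennreal \<bar>f x\<bar> * ennreal (g x) \<partial>lebesgue) \<le> ennreal (\<alpha> / r)"
      if f: "f \<in> X" "N f \<le> 1" for f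
    proof -
      \<comment> \<open>Truncation in height and support leads back to the competitors allowed in the variational
        inequality; Fatou's lemma removes it.\<close>
      define F where "F = (\<lambda>(k::nat) x. min \<bar>f x\<bar> (real k) * indicator E x)"
      note f_meas = measurable[OF f(1)]
      have F_meas: "F k \<in> borel_measurable lebesgue" for k
        unfolding F_def using f_meas E(2) by measurable
      have F_nonneg: "0 \<le> F k x" for k x by (simp add: F_def)
      have F_le: "F k x \<le> real (Suc k) * indicator E x" for k x
        by (simp add: F_def mult_right_mono)
      have F_X: "F k \<in> X" for k
        by (rule bounded_function_closed[OF E F_meas F_nonneg F_le]) simp
      have "N (F k) \<le> N f" for k
        by (rule norm_mono[OF F_X f(1)]) (auto simp: F_def indicator_def)
      then have "N (\<lambda>x. r * F k x) \<le> r" for k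
        using norm_scale[OF F_X, of r k] r(1) f(2) by (simp add: mult_left_le order_trans[of "N (F k)" "N f" 1])
      then have dual_F: "(LINT x|lebesgue. g x * (r * F k x)) \<le> \<alpha>" for k
        unfolding \<alpha>_def g_def using F_meas F_nonneg mult_left_mono[OF F_le, of r] r(1)
        by (intro dual[rule_format, where c = "r * real (Suc k)"]) (auto simp: mult.assoc)
      have bound_F: "(\<integral>\<^sup>+x. ennreal (g x * F k x) \<partial>lebesgue) \<le> ennreal (\<alpha> / r)" for k
      proof -
        have int: "integrable lebesgue (\<lambda>x. g x * F k x)"
        proof (rule integrable_bounded_support[OF E(2) fin, where c="real (Suc k)"])
          fix x show "\<bar>g x * F k x\<bar> \<le> real (Suc k) * indicator E x"
            using g(2,3)[of x] F_nonneg[of k x] F_le[of k x] mult_mono[of "g x" 1 "F k x" "real (Suc k)"]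
            by (cases "x \<in> E") auto
        qed (use g(1) F_meas in auto)
        have "r * (LINT x|lebesgue. g x * F k x) \<le> \<alpha>"
          using dual_F[of k] by (simp add: mult.left_commute)
        then have "(LINT x|lebesgue. g x * F k x) \<le> \<alpha> / r"
          using r(1) by (simp add: field_simps)
        then show ?thesis
          using int g(2) F_nonneg by (simp add: nn_integral_eq_integral ennreal_leI)
      qed
      have lim: "(\<lambda>k. ennreal (g x * F k x)) \<longlonglongrightarrow> ennreal \<bar>f x\<bar> * ennreal (g x)" for x
      proof (rule tendsto_eventually)
        obtain K where K: "\<bar>f x\<bar> \<le> real K" using real_arch_simple by blast
        show "\<forall>\<^sub>F k in sequentially. ennreal (g x * F k x) = ennreal \<bar>f x\<bar> * ennreal (g x)"
        proof (rule eventually_sequentiallyI[of K])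
          fix k assume "K \<le> k"
          then have "F k x = \<bar>f x\<bar> * indicator E x" using K by (simp add: F_def)
          moreover have "x \<notin> E \<Longrightarrow> g x = 0" using g(2,3)[of x] by simp
          ultimately show "ennreal (g x * F k x) = ennreal \<bar>f x\<bar> * ennreal (g x)"
            using g(2)[of x] by (cases "x \<in> E") (auto simp: ennreal_mult[symmetric] mult.commute)
        qed
      qed
      have "(\<integral>\<^sup>+x. ennreal \<bar>f x\<bar> * ennreal (g x) \<partial>lebesgue)
          = (\<integral>\<^sup>+x. liminf (\<lambda>k. ennreal (g x * F k x)) \<partial>lebesgue)"
        by (intro nn_integral_cong lim_imp_Liminf[OF trivial_limit_sequentially lim, symmetric])
      also have "\<dots> \<le> liminf (\<lambda>k. \<integral>\<^sup>+x. ennreal (g x * F k x) \<partial>lebesgue)"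
        using g(1) F_meas by (intro nn_integral_liminf) auto
      also have "\<dots> \<le> ennreal (\<alpha> / r)"
        by (rule Liminf_le) (use bound_F in auto)
      finally show ?thesis .
    qed
    then have "assoc_norm X N (\<lambda>x. ennreal (g x)) \<le> ennreal (\<alpha> / r)"
      unfolding assoc_norm_def by (intro SUP_least) auto
    then have "ennreal r * assoc_norm X N (\<lambda>x. ennreal (g x)) \<le> ennreal r * ennreal (\<alpha> / r)"
      by (rule mult_left_mono) simp
    also have "\<dots> = ennreal \<alpha>"
      using r(1) by (simp add: ennreal_mult'[symmetric])
    also have "\<dots> \<le> ennreal (LINT x|lebesgue. g x)"
      using \<open>\<alpha> \<le> _\<close> by (rule ennreal_leI)
    finally show ?thesis .
  qed
  ultimately show thesis using that[of g] g by blast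
qed

end

section \<open>Norms of indicators of cubes\<close>

lemma nn_integral_eq_set_integral:
  fixes f :: "'a \<Rightarrow> real"
  assumes "set_integrable M A f" "\<And>x. 0 \<le> f x"
  shows "(\<integral>\<^sup>+x\<in>A. ennreal (f x) \<partial>M) = ennreal (LINT x:A|M. f x)"
proof -
  have "(\<integral>\<^sup>+x\<in>A. ennreal (f x) \<partial>M) = (\<integral>\<^sup>+x. ennreal (indicator A x *\<^sub>R f x) \<partial>M)"
    by (intro nn_integral_cong) (simp add: indicator_def)
  also have "\<dots> = ennreal (LINT x:A|M. f x)"
    using assms unfolding set_integrable_def set_lebesgue_integral_def
    by (intro nn_integral_eq_integral) auto
  finally show ?thesis .
qed

lemma HL_maximal_ge_average:
  assumes "is_cube Q" "x \<in> Q"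
  shows "(\<integral>\<^sup>+y\<in>Q. ennreal \<bar>f y\<bar> \<partial>lebesgue) / emeasure lebesgue Q \<le> HL_maximal f x"
  unfolding HL_maximal_def using assms by (intro SUP_upper) simp

context ball_Banach_function_space
begin

lemma set_integrable_bounded:
  assumes E: "bounded E" "E \<in> sets lebesgue" and f: "f \<in> X"
  shows "set_integrable lebesgue E f"
proof -
  obtain C where C: "(\<integral>\<^sup>+x\<in>E. ennreal \<bar>f x\<bar> \<partial>lebesgue) \<le> ennreal (C * N f)"
    using local_integral_bound[OF E] f by blast
  have "(\<integral>\<^sup>+x. ennreal (norm (indicator E x *\<^sub>R f x)) \<partial>lebesgue) = (\<integral>\<^sup>+x\<in>E. ennreal \<bar>f x\<bar> \<partial>lebesgue)"
    by (intro nn_integral_cong) (simp add: indicator_def)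
  also have "\<dots> < \<infinity>" using C by (simp add: order_le_less_trans)
  finally show ?thesis
    unfolding set_integrable_def using measurable[OF f] E(2) by (intro integrableI_bounded) auto
qed

lemma norm_indicator_cube_pos:
  assumes Q: "is_cube Q"
  shows "0 < N (indicat_real Q)"
proof (rule ccontr)
  note X = indicator_closed[OF bounded_cube[OF Q] sets_cube[OF Q]]
  assume "\<not> 0 < N (indicat_real Q)"
  then have "N (indicat_real Q) = 0" using norm_nonneg[OF X] by simp
  then have "AE x in lebesgue. indicat_real Q x = 0" by (rule norm_eq_0[OF X])
  then have "AE x in lebesgue. x \<notin> Q" by eventually_elim (simp add: indicator_def split: if_splits)
  then have "emeasure lebesgue Q = 0"
    using sets_cube[OF Q] by (subst (asm) AE_iff_measurable[of Q]) auto
  then show False using emeasure_cube[OF Q] measure_cube_pos[OF Q] by simp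
qed

text \<open>
  This is the estimate \<open>\<parallel>\<chi>\<parallel>\<^sub>X \<parallel>\<chi>\<parallel>\<^sub>X' \<le> C \<bar>Q\<bar>\<close> for indicators of cubes, combined with
  Hoelder's inequality.  If \<open>g\<close> is a norming function for the indicator, then \<open>M g\<close> is at least
  \<open>\<gamma> / m\<close> on \<open>Q\<close>, where \<open>\<gamma>\<close> is the integral of \<open>g\<close> and \<open>m\<close> the measure of \<open>Q\<close>; testing the
  boundedness of \<open>M\<close> on \<open>g\<close> bounds \<open>\<gamma> / m\<close> times the associate norm of the indicator by a
  multiple of the associate norm of \<open>g\<close>, which is at most \<open>\<gamma> / r\<close>.  The factor \<open>\<gamma>\<close> cancels.
\<close>

lemma norm_indicator_mult_integral_le:
  assumes bounded: "maximal_bounded_on_assoc X N"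
  shows "\<exists>C\<ge>0. \<forall>Q. is_cube Q \<longrightarrow> (\<forall>f\<in>X.
    N (indicat_real Q) * (LINT x:Q|lebesgue. \<bar>f x\<bar>) \<le> C * measure lebesgue Q * N f)"
proof -
  obtain C0 where C0: "\<And>g. g \<in> assoc_space X N \<Longrightarrow>
      assoc_norm X N (HL_maximal g) \<le> ennreal C0 * assoc_norm X N (\<lambda>x. ennreal \<bar>g x\<bar>)"
    using bounded unfolding maximal_bounded_on_assoc_def by blast
  define C where "C = max C0 0"
  have C: "0 \<le> C" "ennreal C = ennreal C0" by (auto simp: C_def max_def ennreal_neg)
  have unit: "N (indicat_real Q) * (LINT x:Q|lebesgue. \<bar>f x\<bar>) \<le> C * measure lebesgue Q"
    if Q: "is_cube Q" and f: "f \<in> X" "N f \<le> 1" for Q f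
  proof -
    define m where "m = measure lebesgue Q"
    define i where "i = (LINT x:Q|lebesgue. \<bar>f x\<bar>)"
    note Qb = bounded_cube[OF Q] and Qs = sets_cube[OF Q]
    have m: "0 < m" "emeasure lebesgue Q = ennreal m"
      using measure_cube_pos[OF Q] emeasure_cube[OF Q] by (simp_all add: m_def)
    have i_nonneg: "0 \<le> i" by (simp add: i_def set_lebesgue_integral_def)
    have i: "(\<integral>\<^sup>+x\<in>Q. ennreal \<bar>f x\<bar> \<partial>lebesgue) = ennreal i"
      unfolding i_def
      by (rule nn_integral_eq_set_integral[OF set_integrable_abs[OF set_integrable_bounded[OF Qb Qs f(1)]]]) simp
    have below: "r * i \<le> C * m" if r: "0 < r" "r < N (indicat_real Q)" for r
    proof -
      obtain g where g: "g \<in> borel_measurable lebesgue" "\<And>x. 0 \<le> g x" "\<And>x. g x \<le> indicator Q x"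
        and pos: "0 < (LINT x|lebesgue. g x)"
        and norming: "ennreal r * assoc_norm X N (\<lambda>x. ennreal (g x)) \<le> ennreal (LINT x|lebesgue. g x)"
        using norming_function[OF Qb Qs r] by blast
      define \<gamma> where "\<gamma> = (LINT x|lebesgue. g x)"
      define s where "s = assoc_norm X N (\<lambda>x. ennreal (g x))"
      have "\<gamma> > 0" using pos by (simp add: \<gamma>_def)
      have rs: "ennreal r * s \<le> ennreal \<gamma>" using norming by (simp add: s_def \<gamma>_def)
      have "ennreal r * s \<noteq> top"
        by (rule neq_top_trans[OF ennreal_neq_top rs])
      then have "s < \<infinity>"
        using r(1) by (simp add: ennreal_mult_eq_top_iff less_top)
      then have "g \<in> assoc_space X N"
        using g by (simp add: assoc_space_def s_def)
      then have max: "assoc_norm X N (HL_maximal g) \<le> ennreal C * s"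
        using C0[of g] g(2) C(2) by (simp add: s_def)
      have "integrable lebesgue g"
        using pos not_integrable_integral_eq by fastforce
      then have "(\<integral>\<^sup>+x. ennreal (g x) \<partial>lebesgue) = ennreal \<gamma>"
        using g(2) by (simp add: nn_integral_eq_integral \<gamma>_def)
      moreover have "(\<integral>\<^sup>+x\<in>Q. ennreal \<bar>g x\<bar> \<partial>lebesgue) = (\<integral>\<^sup>+x. ennreal (g x) \<partial>lebesgue)"
      proof (rule nn_integral_cong)
        fix x show "ennreal \<bar>g x\<bar> * indicator Q x = ennreal (g x)"
          using g(2,3)[of x] by (cases "x \<in> Q") auto
      qed
      ultimately have avg: "ennreal (\<gamma> / m) \<le> HL_maximal g x" if "x \<in> Q" for x
        using HL_maximal_ge_average[OF Q that, of g] m \<open>\<gamma> > 0\<close> by (simp add: divide_ennreal)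
      have "ennreal (\<gamma> / m) * ennreal i = (\<integral>\<^sup>+x. ennreal (\<gamma> / m) * (ennreal \<bar>f x\<bar> * indicator Q x) \<partial>lebesgue)"
        using measurable[OF f(1)] Qs by (simp add: nn_integral_cmult i)
      also have "\<dots> \<le> (\<integral>\<^sup>+x. ennreal \<bar>f x\<bar> * HL_maximal g x \<partial>lebesgue)"
      proof (rule nn_integral_mono)
        fix x show "ennreal (\<gamma> / m) * (ennreal \<bar>f x\<bar> * indicator Q x) \<le> ennreal \<bar>f x\<bar> * HL_maximal g x"
          using mult_left_mono[OF avg[of x], of "ennreal \<bar>f x\<bar>"] by (cases "x \<in> Q") (auto simp: mult.commute)
      qed
      also have "\<dots> \<le> assoc_norm X N (HL_maximal g)"
        unfolding assoc_norm_def using f by (intro SUP_upper) auto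
      also have "\<dots> \<le> ennreal C * s" by (rule max)
      finally have "ennreal r * (ennreal (\<gamma> / m) * ennreal i) \<le> ennreal r * (ennreal C * s)"
        by (rule mult_left_mono) simp
      also have "\<dots> = ennreal C * (ennreal r * s)" by (simp add: mult.left_commute)
      also have "\<dots> \<le> ennreal C * ennreal \<gamma>" by (rule mult_left_mono[OF rs]) simp
      finally have "r * (\<gamma> / m * i) \<le> C * \<gamma>"
        using r(1) \<open>\<gamma> > 0\<close> m(1) i_nonneg C(1) by (simp add: ennreal_mult[symmetric])
      then have "\<gamma> * (r * i) \<le> \<gamma> * (C * m)"
        using m(1) by (simp add: field_simps)
      then show ?thesis using \<open>\<gamma> > 0\<close> by simp
    qed
    \<comment> \<open>Letting \<open>r\<close> increase to the norm of the indicator.\<close>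
    have "N (indicat_real Q) * i \<le> C * m"
    proof (rule ccontr)
      assume "\<not> N (indicat_real Q) * i \<le> C * m"
      then have gt: "C * m < N (indicat_real Q) * i" by simp
      have "0 \<le> C * m" using C(1) m(1) by simp
      have "0 < i" using gt \<open>0 \<le> C * m\<close> i_nonneg by (cases "i = 0") auto
      then have "C * m / i < N (indicat_real Q)" using gt by (simp add: divide_less_eq)
      then obtain r where r: "C * m / i < r" "r < N (indicat_real Q)" using dense by blast
      moreover have "0 < r" using r(1) \<open>0 < i\<close> \<open>0 \<le> C * m\<close>
        by (meson divide_nonneg_pos order_le_less_trans)
      ultimately show False using below[of r] \<open>0 < i\<close> by (simp add: divide_less_eq)
    qed
    then show ?thesis by (simp add: i_def m_def)
  qed
  have "N (indicat_real Q) * (LINT x:Q|lebesgue. \<bar>f x\<bar>) \<le> C * measure lebesgue Q * N f"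
    if Q: "is_cube Q" and f: "f \<in> X" for Q f
  proof (cases "N f = 0")
    case True
    then have "AE x in lebesgue. f x = 0" by (rule norm_eq_0[OF f])
    then have "AE x in lebesgue. indicator Q x *\<^sub>R \<bar>f x\<bar> = 0"
      by eventually_elim simp
    then have "(LINT x:Q|lebesgue. \<bar>f x\<bar>) = 0"
      unfolding set_lebesgue_integral_def by (rule integral_eq_zero_AE)
    then show ?thesis using True by simp
  next
    case False
    then have "0 < N f" using norm_nonneg[OF f] by simp
    have "N (\<lambda>x. (1 / N f) * f x) \<le> 1"
      using \<open>0 < N f\<close> by (subst norm_scale[OF f]) simp
    from unit[OF Q scale_closed[OF f] this]
    have "N (indicat_real Q) * ((LINT x:Q|lebesgue. \<bar>f x\<bar>) / N f) \<le> C * measure lebesgue Q"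
      using \<open>0 < N f\<close> by (simp add: abs_mult)
    then show ?thesis using \<open>0 < N f\<close> by (simp add: field_simps)
  qed
  then show ?thesis using C(1) by blast
qed

end

section \<open>The commutator on cubes\<close>

lemma HL_maximal_indicator:
  assumes Q: "is_cube Q" and "x \<in> Q"
  shows "HL_maximal (indicat_real Q) x = 1"
proof (rule antisym)
  have self: "e / e = 1" if "e = ennreal m" "0 < m" for e m
    using that by (simp add: divide_ennreal)
  show "HL_maximal (indicat_real Q) x \<le> 1"
    unfolding HL_maximal_def
  proof (rule SUP_least)
    fix R assume "R \<in> {Q. is_cube Q \<and> x \<in> Q}"
    then have R: "is_cube R" by simp
    have "(\<integral>\<^sup>+y\<in>R. ennreal \<bar>indicat_real Q y\<bar> \<partial>lebesgue) \<le> (\<integral>\<^sup>+y. indicator R y \<partial>lebesgue)"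
      by (intro nn_integral_mono) (simp add: indicator_def)
    also have "\<dots> = emeasure lebesgue R"
      using sets_cube[OF R] by (rule nn_integral_indicator)
    finally have "(\<integral>\<^sup>+y\<in>R. ennreal \<bar>indicat_real Q y\<bar> \<partial>lebesgue) / emeasure lebesgue R
        \<le> emeasure lebesgue R / emeasure lebesgue R"
      by (rule divide_right_mono_ennreal)
    also have "\<dots> = 1"
      by (rule self[OF emeasure_cube[OF R] measure_cube_pos[OF R]])
    finally show "(\<integral>\<^sup>+y\<in>R. ennreal \<bar>indicat_real Q y\<bar> \<partial>lebesgue) / emeasure lebesgue R \<le> 1" .
  qed
  have "(\<integral>\<^sup>+y\<in>Q. ennreal \<bar>indicat_real Q y\<bar> \<partial>lebesgue) = (\<integral>\<^sup>+y. indicator Q y \<partial>lebesgue)"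
    by (intro nn_integral_cong) (simp add: indicator_def)
  also have "\<dots> = emeasure lebesgue Q"
    using sets_cube[OF Q] by (rule nn_integral_indicator)
  finally have "1 = (\<integral>\<^sup>+y\<in>Q. ennreal \<bar>indicat_real Q y\<bar> \<partial>lebesgue) / emeasure lebesgue Q"
    using self[OF emeasure_cube[OF Q] measure_cube_pos[OF Q]] by simp
  also have "\<dots> \<le> HL_maximal (indicat_real Q) x"
    by (rule HL_maximal_ge_average[OF assms])
  finally show "1 \<le> HL_maximal (indicat_real Q) x" .
qed

text \<open>
  The indicator of \<open>Q\<close> has maximal function \<open>1\<close> on \<open>Q\<close>, so there the commutator is \<open>b\<close> minus the
  maximal function of \<open>b\<close> restricted to \<open>Q\<close>, which is at least the average of \<open>\<bar>b\<bar>\<close> over \<open>Q\<close>.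
\<close>

lemma average_abs_le_minus_commutator:
  assumes Q: "is_cube Q" "x \<in> Q" and b: "set_integrable lebesgue Q b"
    and comm: "max_commutator b (indicat_real Q) x = ereal y"
  shows "avg Q (\<lambda>z. \<bar>b z\<bar>) \<le> b x - y"
proof -
  let ?M = "HL_maximal (\<lambda>z. b z * indicat_real Q z) x"
  have eq: "ereal (b x) - enn2ereal ?M = ereal y"
    using comm by (simp add: max_commutator_def HL_maximal_indicator[OF Q] one_ennreal.rep_eq)
  then obtain m where m: "0 \<le> m" "?M = ennreal m"
    by (cases ?M) auto
  have "m = b x - y" using eq m by simp
  have "(\<integral>\<^sup>+z\<in>Q. ennreal \<bar>b z * indicat_real Q z\<bar> \<partial>lebesgue) = (\<integral>\<^sup>+z\<in>Q. ennreal \<bar>b z\<bar> \<partial>lebesgue)"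
    by (intro nn_integral_cong) (simp add: indicator_def)
  also have "\<dots> = ennreal (LINT z:Q|lebesgue. \<bar>b z\<bar>)"
    by (rule nn_integral_eq_set_integral[OF set_integrable_abs[OF b]]) simp
  finally have "ennreal (LINT z:Q|lebesgue. \<bar>b z\<bar>) / ennreal (measure lebesgue Q) \<le> ennreal m"
    using HL_maximal_ge_average[OF Q, of "\<lambda>z. b z * indicat_real Q z"] m(2) emeasure_cube[OF Q(1)] by simp
  moreover have "0 \<le> (LINT z:Q|lebesgue. \<bar>b z\<bar>)"
    by (simp add: set_lebesgue_integral_def)
  ultimately have "avg Q (\<lambda>z. \<bar>b z\<bar>) \<le> m"
    using measure_cube_pos[OF Q(1)] m(1) by (simp add: divide_ennreal avg_def)
  then show ?thesis using \<open>m = b x - y\<close> by simp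
qed

text \<open>
  The deviation of \<open>b\<close> below the average of \<open>\<bar>b\<bar>\<close> controls both quantities.  The average \<open>a\<close> of \<open>b\<close> is at most that of \<open>\<bar>b\<bar>\<close>, so \<open>a - b \<le> \<bar>h\<bar>\<close>, and
  \<open>b - a\<close> has mean zero, whence the oscillation is at most twice the average of \<open>\<bar>h\<bar>\<close>; and the
  average of \<open>\<bar>b\<bar> - b\<close>, at most that of \<open>\<bar>h\<bar>\<close>, is twice that of the negative part.
\<close>

lemma oscillation_and_neg_part_bound:
  fixes b h :: "'a::euclidean_space \<Rightarrow> real"
  assumes Q: "is_cube Q" and b: "set_integrable lebesgue Q b" and h: "set_integrable lebesgue Q h"
    and le: "AE x in lebesgue. x \<in> Q \<longrightarrow> avg Q (\<lambda>z. \<bar>b z\<bar>) - b x \<le> \<bar>h x\<bar>"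
    and K: "(LINT x:Q|lebesgue. \<bar>h x\<bar>) \<le> K * measure lebesgue Q"
  shows "avg Q (\<lambda>x. \<bar>b x - avg Q b\<bar>) \<le> 2 * K"
    and "(\<integral>\<^sup>+x\<in>Q. ennreal (neg_part b x) \<partial>lebesgue) \<le> ennreal K * emeasure lebesgue Q"
proof -
  let ?m = "measure lebesgue Q"
  define a where "a = avg Q b"
  define A where "A = avg Q (\<lambda>z. \<bar>b z\<bar>)"
  note Qs = sets_cube[OF Q] and mpos = measure_cube_pos[OF Q]
  have const: "set_integrable lebesgue Q (\<lambda>x. c)" "(LINT x:Q|lebesgue. c) = c * ?m" for c :: real
    using Qs emeasure_cube[OF Q] by (simp_all add: set_integrable_def set_lebesgue_integral_def del: emeasure_completion measure_completion)
  note abs_b = set_integrable_abs[OF b] and abs_h = set_integrable_abs[OF h]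
  have a: "(LINT x:Q|lebesgue. b x) = a * ?m" and A: "(LINT x:Q|lebesgue. \<bar>b x\<bar>) = A * ?m"
    using mpos by (simp_all add: a_def A_def avg_def)
  have "a \<le> A"
    unfolding a_def A_def avg_def using mpos b abs_b
    by (intro divide_right_mono set_integral_mono) auto
  have ba: "set_integrable lebesgue Q (\<lambda>x. b x - a)" "(LINT x:Q|lebesgue. b x - a) = 0"
    using b const a by simp_all
  have Ab: "set_integrable lebesgue Q (\<lambda>x. A - b x)" "(LINT x:Q|lebesgue. A - b x) = (A - a) * ?m"
    using b const a by (simp_all add: left_diff_distrib)
  have h2: "set_integrable lebesgue Q (\<lambda>x. 2 * \<bar>h x\<bar>)" "(LINT x:Q|lebesgue. 2 * \<bar>h x\<bar>) \<le> 2 * (K * ?m)"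
    using abs_h K by simp_all
  have "(LINT x:Q|lebesgue. \<bar>b x - a\<bar>) \<le> (LINT x:Q|lebesgue. 2 * \<bar>h x\<bar> + (b x - a))"
  proof (rule set_integral_mono_AE)
    show "set_integrable lebesgue Q (\<lambda>x. \<bar>b x - a\<bar>)" by (rule set_integrable_abs[OF ba(1)])
    show "set_integrable lebesgue Q (\<lambda>x. 2 * \<bar>h x\<bar> + (b x - a))" using h2(1) ba(1) by (rule set_integral_add)
    show "AE x\<in>Q in lebesgue. \<bar>b x - a\<bar> \<le> 2 * \<bar>h x\<bar> + (b x - a)"
      using le
    proof eventually_elim
      case (elim x)
      show ?case using elim \<open>a \<le> A\<close> unfolding A_def[symmetric] by linarith
    qed
  qed
  also have "\<dots> = (LINT x:Q|lebesgue. 2 * \<bar>h x\<bar>) + (LINT x:Q|lebesgue. b x - a)"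
    using h2(1) ba(1) by (rule set_integral_add)
  also have "\<dots> \<le> 2 * K * ?m"
    using h2(2) ba(2) by simp
  finally show "avg Q (\<lambda>x. \<bar>b x - avg Q b\<bar>) \<le> 2 * K"
    using mpos unfolding a_def[symmetric] by (subst avg_def) (simp add: divide_le_eq)
  have "(LINT x:Q|lebesgue. A - b x) \<le> (LINT x:Q|lebesgue. \<bar>h x\<bar>)"
    by (rule set_integral_mono_AE[OF Ab(1) abs_h]) (use le in \<open>simp add: A_def\<close>)
  then have "(A - a) * ?m \<le> K * ?m"
    using K Ab(2) by simp
  have neg: "neg_part b x = (\<bar>b x\<bar> - b x) / 2" for x
    by (simp add: neg_part_def)
  have neg_int: "set_integrable lebesgue Q (neg_part b)"
    unfolding neg using abs_b b by simp
  have "(LINT x:Q|lebesgue. neg_part b x) = ((A - a) * ?m) / 2"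
    unfolding neg using abs_b b a A by (simp add: left_diff_distrib)
  also have "\<dots> \<le> K * ?m"
    using \<open>(A - a) * ?m \<le> K * ?m\<close> \<open>a \<le> A\<close> mpos mult_nonneg_nonneg[of "A - a" ?m] by linarith
  finally have le_K: "(LINT x:Q|lebesgue. neg_part b x) \<le> K * ?m" .
  have "(\<integral>\<^sup>+x\<in>Q. ennreal (neg_part b x) \<partial>lebesgue) = ennreal (LINT x:Q|lebesgue. neg_part b x)"
    by (rule nn_integral_eq_set_integral[OF neg_int]) (simp add: neg_part_def)
  also have "\<dots> \<le> ennreal (K * ?m)" using le_K by (rule ennreal_leI)
  also have "\<dots> = ennreal K * emeasure lebesgue Q"
    unfolding emeasure_cube[OF Q] by (rule ennreal_mult'') simp
  finally show "(\<integral>\<^sup>+x\<in>Q. ennreal (neg_part b x) \<partial>lebesgue) \<le> ennreal K * emeasure lebesgue Q" .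
qed

theorem theorem5p4:
  fixes X :: "(real ^ 'n \<Rightarrow> real) set"
    and N :: "(real ^ 'n \<Rightarrow> real) \<Rightarrow> real"
    and b :: "real ^ 'n \<Rightarrow> real"
  assumes "ball_Banach_function_space X N"
    and "maximal_bounded_on_assoc X N"
    and "b \<in> L1_loc"
    and "max_commutator_bounded X N b"
  shows "b \<in> BMO \<and> neg_part b \<in> L_inf"
proof -
  interpret ball_Banach_function_space X N by fact
  obtain C where C: "0 \<le> C" "\<And>Q f. is_cube Q \<Longrightarrow> f \<in> X \<Longrightarrow>
      N (indicat_real Q) * (LINT x:Q|lebesgue. \<bar>f x\<bar>) \<le> C * measure lebesgue Q * N f"
    using norm_indicator_mult_integral_le[OF assms(2)] by blast
  obtain D where D: "\<And>f. f \<in> X \<Longrightarrow>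
      \<exists>h\<in>X. (AE x in lebesgue. max_commutator b f x = ereal (h x)) \<and> N h \<le> D * N f"
    using assms(4) unfolding max_commutator_bounded_def by blast
  define K where "K = max (C * D) 0"
  have b_int: "set_integrable lebesgue S b" if "compact S" for S
    using assms(3) that by (simp add: L1_loc_def)
  have cube: "avg Q (\<lambda>x. \<bar>b x - avg Q b\<bar>) \<le> 2 * K"
    "(\<integral>\<^sup>+x\<in>Q. ennreal (neg_part b x) \<partial>lebesgue) \<le> ennreal K * emeasure lebesgue Q"
    if Q: "is_cube Q" for Q
  proof -
    note Q_X = indicator_closed[OF bounded_cube[OF Q] sets_cube[OF Q]]
    obtain h where h: "h \<in> X" "AE x in lebesgue. max_commutator b (indicat_real Q) x = ereal (h x)"
      "N h \<le> D * N (indicat_real Q)"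
      using D[OF Q_X] by blast
    let ?m = "measure lebesgue Q"
    have "N (indicat_real Q) * (LINT x:Q|lebesgue. \<bar>h x\<bar>) \<le> C * ?m * N h"
      by (rule C(2)[OF Q h(1)])
    also have "\<dots> \<le> C * ?m * (D * N (indicat_real Q))"
      using h(3) C(1) by (intro mult_left_mono) auto
    finally have "(LINT x:Q|lebesgue. \<bar>h x\<bar>) \<le> C * D * ?m"
      using norm_indicator_cube_pos[OF Q] by (simp add: mult.commute mult.left_commute)
    also have "\<dots> \<le> K * ?m" by (intro mult_right_mono) (auto simp: K_def)
    finally have K: "(LINT x:Q|lebesgue. \<bar>h x\<bar>) \<le> K * ?m" .
    have le: "AE x in lebesgue. x \<in> Q \<longrightarrow> avg Q (\<lambda>z. \<bar>b z\<bar>) - b x \<le> \<bar>h x\<bar>"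
      using h(2)
    proof eventually_elim
      case (elim x)
      show ?case
        using average_abs_le_minus_commutator[OF Q _ b_int[OF compact_cube[OF Q]] elim] by fastforce
    qed
    note bounds = oscillation_and_neg_part_bound[OF Q b_int[OF compact_cube[OF Q]]
        set_integrable_bounded[OF bounded_cube[OF Q] sets_cube[OF Q] h(1)] le K]
    show "avg Q (\<lambda>x. \<bar>b x - avg Q b\<bar>) \<le> 2 * K"
      "(\<integral>\<^sup>+x\<in>Q. ennreal (neg_part b x) \<partial>lebesgue) \<le> ennreal K * emeasure lebesgue Q"
      by (fact bounds)+
  qed
  \<comment> \<open>Local integrability gives measurability only on compact sets; balls exhaust the space.\<close>
  have "b \<in> borel_measurable lebesgue"
  proof (rule borel_measurable_LIMSEQ_real)
    show "(\<lambda>n. indicator (cball 0 (real n)) x * b x) \<longlonglongrightarrow> b x" for x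
    proof (rule tendsto_eventually)
      obtain k where "norm x \<le> real k" using real_arch_simple by blast
      then show "\<forall>\<^sub>F n in sequentially. indicator (cball 0 (real n)) x * b x = b x"
        by (intro eventually_sequentiallyI[of k]) auto
    qed
    show "(\<lambda>x. indicator (cball 0 (real n)) x * b x) \<in> borel_measurable lebesgue" for n
      using borel_measurable_integrable[OF b_int[OF compact_cball[of 0 "real n"], unfolded set_integrable_def]]
      by simp
  qed
  then have neg_meas: "neg_part b \<in> borel_measurable lebesgue"
    unfolding neg_part_def by measurable
  have "AE x in lebesgue. neg_part b x \<le> K"
    by (rule AE_le_of_cubes[OF neg_meas _ cube(2)]) (simp_all add: K_def)
  then have "AE x in lebesgue. \<bar>neg_part b x\<bar> \<le> K"
    by eventually_elim (simp add: neg_part_def)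
  then have "neg_part b \<in> L_inf"
    using neg_meas unfolding L_inf_def by blast
  moreover have "b \<in> BMO"
    using assms(3) cube(1) by (auto simp: BMO_def bdd_above_def)
  ultimately show ?thesis by blast
qed

end
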